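(* Let $\ell\ge 1$ be an integer, $\theta=2\ell+1$, and let $m=m(n)$ satisfy $$m\sim\frac{n^{1/\ell}}{(\log n)^{1+1/\ell}}\qquad(n\to\infty).$$ Consider bootstrap percolation with threshold $\theta$ on $\mathbb{Z}_m\times K_n^2$ with initial density $p=p(n)$ satisfying, for a constant $a>0$, $$p\sim a\cdot\frac{(\log n)^{1/\ell}}{n^{1+1/\ell}}\qquad (n\to\infty).$$ Then, as $n\to\infty$, $$\mathbb{P}_p(\mathrm{Span})\to\begin{cases}0 & \text{if } a^\ell/\ell!<1/\ell,\\ 1-\exp\left(-2a^{\ell+1}/(\ell+1)!\right) & \text{if } a^\ell/\ell!>1/\ell.\end{cases}$$
   Context: $\mathbb{Z}_m$ denotes the cycle graph on $m$ vertices, $K_n$ the complete graph on $n$ vertices, $K_n^2=K_n\times K_n$, and $\times$ the Cartesian product of graphs. Bootstrap percolation with threshold $\theta$ on a finite graph with vertex set $V$: starting from $\omega=\omega_0\in\{0,1\}^V$, set $\omega_{j+1}(v)=1$ if $\omega_j(v)=1$ or $\sum_{w\sim v}\omega_j(w)\ge\theta$, and $\omega_{j+1}(v)=0$ otherwise; $\omega_\infty$ is the pointwise limit. Under $\mathbb{P}_p$ the initial values $\{\omega(v):v\in V\}$ are i.i.d. Bernoulli($p$). $\mathrm{Span}=\{\omega_\infty\equiv 1\}$. *)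

theory Defs
  imports "HOL-Probability.Probability" "Graph_Theory.Graph_Theory"
begin

section \<open>The graphs\<close>

text \<open>A finite simple graph is a \<^locale>\<open>pair_graph\<close>: a finite vertex set together with a symmetric,
  loop-free set of arcs, so that each edge is represented by its two orientations.\<close>

definition cycle_graph :: "nat \<Rightarrow> nat pair_pre_digraph" where
  "cycle_graph m = \<lparr> pverts = {..<m},
     parcs = {(i, j). i < m \<and> j < m \<and> i \<noteq> j \<and> (j = (i + 1) mod m \<or> i = (j + 1) mod m)} \<rparr>"

definition clique_graph :: "nat \<Rightarrow> nat pair_pre_digraph" where
  "clique_graph n = \<lparr> pverts = {..<n}, parcs = {(i, j). i < n \<and> j < n \<and> i \<noteq> j} \<rparr>"

definition cartesian_product ::
    "'a pair_pre_digraph \<Rightarrow> 'b pair_pre_digraph \<Rightarrow> ('a \<times> 'b) pair_pre_digraph" where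
  "cartesian_product G H = \<lparr> pverts = pverts G \<times> pverts H,
     parcs = {((u, x), (v, y)).
        (u = v \<and> u \<in> pverts G \<and> (x, y) \<in> parcs H) \<or>
        (x = y \<and> x \<in> pverts H \<and> (u, v) \<in> parcs G)} \<rparr>"

lemma pair_graph_iff:
  "pair_graph G \<longleftrightarrow> finite (pverts G) \<and> parcs G \<subseteq> pverts G \<times> pverts G \<and>
     (\<forall>u v. (u, v) \<in> parcs G \<longrightarrow> u \<noteq> v \<and> (v, u) \<in> parcs G)" (is "_ \<longleftrightarrow> ?R")
proof
  assume "pair_graph G"
  then interpret pair_graph G .
  have "parcs G \<subseteq> pverts G \<times> pverts G"
    using in_arcsD1 in_arcsD2 by auto
  moreover have "u \<noteq> v \<and> (v, u) \<in> parcs G" if "(u, v) \<in> parcs G" for u v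
    using pair_no_loops[OF that] pair_sym_arcs that by (simp add: symmetric_def symD)
  ultimately show ?R
    using pair_finite_verts by blast
next
  assume R: ?R
  then have "finite (parcs G)"
    using finite_subset by blast
  with R show "pair_graph G"
    by unfold_locales (auto simp: symmetric_def sym_def)
qed

lemma pair_graph_cycle_graph: "pair_graph (cycle_graph m)"
  by (auto simp: pair_graph_iff cycle_graph_def)

lemma complete_digraph_clique_graph:
  "complete_digraph n (with_proj (clique_graph n))"
proof -
  have "pair_graph (clique_graph n)"
    by (auto simp: pair_graph_iff clique_graph_def)
  then have "graph (with_proj (clique_graph n))"
    by (rule pair_graph.pair_graphD_graph)
  then show ?thesis
    by (auto simp: complete_digraph_def clique_graph_def)
qed

lemma pair_graph_cartesian_product:
  assumes "pair_graph G" "pair_graph H"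
  shows "pair_graph (cartesian_product G H)"
  using assms unfolding pair_graph_iff by (auto simp: cartesian_product_def)

section \<open>Bootstrap percolation\<close>

text \<open>A configuration is a map to \<^typ>\<open>bool\<close>, with \<^const>\<open>True\<close> for the value \<open>1\<close>.\<close>

definition bootstrap_step ::
    "'v pair_pre_digraph \<Rightarrow> nat \<Rightarrow> ('v \<Rightarrow> bool) \<Rightarrow> ('v \<Rightarrow> bool)" where
  "bootstrap_step G \<theta> \<omega> = (\<lambda>v. \<omega> v \<or> (\<Sum>w | (w, v) \<in> parcs G. of_bool (\<omega> w)) \<ge> \<theta>)"

definition bootstrap ::
    "'v pair_pre_digraph \<Rightarrow> nat \<Rightarrow> ('v \<Rightarrow> bool) \<Rightarrow> nat \<Rightarrow> ('v \<Rightarrow> bool)" where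
  "bootstrap G \<theta> \<omega> j = (bootstrap_step G \<theta> ^^ j) \<omega>"

text \<open>The pointwise limit is taken in the discrete topology of \<^typ>\<open>bool\<close>; it always exists, see below.\<close>

definition bootstrap_limit ::
    "'v pair_pre_digraph \<Rightarrow> nat \<Rightarrow> ('v \<Rightarrow> bool) \<Rightarrow> ('v \<Rightarrow> bool)" where
  "bootstrap_limit G \<theta> \<omega> = (\<lambda>v. lim (\<lambda>j. bootstrap G \<theta> \<omega> j v))"

definition Span :: "'v pair_pre_digraph \<Rightarrow> nat \<Rightarrow> ('v \<Rightarrow> bool) set" where
  "Span G \<theta> = {\<omega>. \<forall>v\<in>pverts G. bootstrap_limit G \<theta> \<omega> v}"

text \<open>I.i.d. Bernoulli variables indexed by the vertices; outside the vertex set the configuration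
  is constantly \<^const>\<open>False\<close>.\<close>

definition initial_pmf :: "'v pair_pre_digraph \<Rightarrow> real \<Rightarrow> ('v \<Rightarrow> bool) pmf" where
  "initial_pmf G p = Pi_pmf (pverts G) False (\<lambda>_. bernoulli_pmf p)"

lemma bootstrap_mono:
  assumes "i \<le> j" "bootstrap G \<theta> \<omega> i v"
  shows "bootstrap G \<theta> \<omega> j v"
  using assms by (induction j rule: dec_induct) (auto simp: bootstrap_def bootstrap_step_def)

lemma bootstrap_tendsto:
  "(\<lambda>j. bootstrap G \<theta> \<omega> j v) \<longlonglongrightarrow> (\<exists>j. bootstrap G \<theta> \<omega> j v)"
proof -
  have "\<exists>i. \<forall>k\<ge>i. bootstrap G \<theta> \<omega> k v \<longleftrightarrow> (\<exists>j. bootstrap G \<theta> \<omega> j v)"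
  proof (cases "\<exists>j. bootstrap G \<theta> \<omega> j v")
    case True
    then show ?thesis
      by (metis bootstrap_mono)
  next
    case False
    then show ?thesis
      by simp
  qed
  then show ?thesis
    by (simp add: tendsto_discrete eventually_sequentially)
qed

lemma bootstrap_limit_iff: "bootstrap_limit G \<theta> \<omega> v \<longleftrightarrow> (\<exists>j. bootstrap G \<theta> \<omega> j v)"
  unfolding bootstrap_limit_def by (simp only: limI[OF bootstrap_tendsto])

end

theory Submission
  imports Defs "HOL-Real_Asymp.Real_Asymp"
begin


text \<open>Proof idea. Call a row or column of one of the planes \<open>{i} \<times> K\<^sub>n\<^sup>2\<close> a line, and a line with at
  least \<open>l + 1\<close> initially infected sites a nucleus. The number of nuclei is asymptotically Poisson with
  mean \<open>2 a\<^bsup>l+1\<^esup> / (l+1)!\<close>, and without a nucleus the initial configuration is with high probability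
  already stable. The number of rows of a plane with at least \<open>l\<close> infected sites has mean about
  \<open>(a\<^sup>l / l!) log n\<close>, to be compared with \<open>log m \<sim> (1 / l) log n\<close>. If \<open>a\<^sup>l / l! > 1 / l\<close>, every plane
  has many such rows and columns, so a nucleus fills its plane, and a full plane fills the neighbouring
  ones. If \<open>a\<^sup>l / l! < 1 / l\<close>, then among the first \<open>2 n\<^sup>c\<close> planes, where \<open>a\<^sup>l / l! < c < 1 / l\<close>, there are
  with high probability two planes without any such row but no nucleus; the arc between these two planes
  never fills up, even if everything outside it is infected.\<close>

section \<open>Deterministic growth and blocking\<close>

text \<open>Both effects live on one scale. With these rates n^(l+1) p^l ~ a^l log n, so a plane
  misses all rows with at least l sites with probability n^(-a^l / l! + o(1)), while m n^(l+2)
  p^(l+1) tends to a^(l+1), which over the 2mn lines gives a bounded mean number of nuclei. A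
  nucleus works because l + 1 sites on a row and l on a crossing column add up to the threshold. The
  obstacle is dependence: rows and columns of a plane share sites. Distinct planes are independent,
  so the probability of having no nucleus is a product over planes, and only the probability for a
  single plane has to be known to first order; the limit of an m-th power replaces a Poisson
  approximation. The remaining events (a row and a column nucleus in one plane, lines with l + 2
  sites, crosses) are removed by first moments. Blocking planes are sought among about n^c planes
  only: c > a^l / l! makes them likely there, and c < 1 / l makes nuclei there unlikely.\<close>

definition cyc_cliques :: "nat \<Rightarrow> nat \<Rightarrow> (nat \<times> nat \<times> nat) pair_pre_digraph" where
  "cyc_cliques m n = cartesian_product (cycle_graph m)
     (cartesian_product (clique_graph n) (clique_graph n))"

text \<open>The flag selects the order of the two coordinates within a plane, so that facts about rows and
  columns are proved simultaneously: \<open>site b i x\<close> ranges over line \<open>x\<close> of orientation \<open>b\<close>.\<close>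

definition site :: "bool \<Rightarrow> nat \<Rightarrow> nat \<Rightarrow> nat \<Rightarrow> nat \<times> nat \<times> nat" where
  "site b i x y = (if b then (i, x, y) else (i, y, x))"

definition line_count :: "nat \<Rightarrow> bool \<Rightarrow> (nat \<times> nat \<times> nat \<Rightarrow> bool) \<Rightarrow> nat \<Rightarrow> nat \<Rightarrow> nat" where
  "line_count n b C i x = card {y. y < n \<and> C (site b i x y)}"

definition cyc_adj :: "nat \<Rightarrow> nat \<Rightarrow> nat \<Rightarrow> bool" where
  "cyc_adj m i j \<longleftrightarrow> i \<noteq> j \<and> (j = (i + 1) mod m \<or> i = (j + 1) mod m)"

definition adj_count :: "nat \<Rightarrow> bool \<Rightarrow> (nat \<times> nat \<times> nat \<Rightarrow> bool) \<Rightarrow> nat \<Rightarrow> nat \<Rightarrow> nat \<Rightarrow> nat" where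
  "adj_count m b C i x y = card {j. j < m \<and> cyc_adj m i j \<and> C (site b j x y)}"

section \<open>Closed configurations and spanning\<close>

definition perc_closed :: "'v pair_pre_digraph \<Rightarrow> nat \<Rightarrow> ('v \<Rightarrow> bool) \<Rightarrow> bool" where
  "perc_closed G \<theta> C \<longleftrightarrow>
     (\<forall>v\<in>pverts G. \<theta> \<le> card {u. (u, v) \<in> parcs G \<and> C u} \<longrightarrow> C v)"

lemma sum_of_bool_arcs:
  assumes "pair_graph G"
  shows "(\<Sum>w | (w, v) \<in> parcs G. of_bool (C w) :: nat) = card {u. (u, v) \<in> parcs G \<and> C u}"
proof -
  have fin: "finite {w. (w, v) \<in> parcs G}"
    using assms unfolding pair_graph_iff by (auto intro: finite_subset[of _ "pverts G"])
  have "(\<Sum>w | (w, v) \<in> parcs G. of_bool (C w) :: nat) = card ({w. (w, v) \<in> parcs G} \<inter> {w. C w})"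
    using fin by (simp add: sum.If_cases of_bool_def)
  also have "{w. (w, v) \<in> parcs G} \<inter> {w. C w} = {u. (u, v) \<in> parcs G \<and> C u}"
    by blast
  finally show ?thesis .
qed

lemma bootstrap_subset_closed:
  assumes G: "pair_graph G" and C: "perc_closed G \<theta> C" and w: "\<And>v. v \<in> pverts G \<Longrightarrow> w v \<Longrightarrow> C v"
  shows "v \<in> pverts G \<Longrightarrow> bootstrap G \<theta> w j v \<Longrightarrow> C v"
proof (induction j arbitrary: v)
  case 0
  then show ?case using w by (simp add: bootstrap_def)
next
  case (Suc j)
  have fin: "finite {u. (u, v) \<in> parcs G \<and> C u}"
    using G unfolding pair_graph_iff by (auto intro: finite_subset[of _ "pverts G"])
  from Suc.prems(2) consider "bootstrap G \<theta> w j v"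
    | "\<theta> \<le> card {u. (u, v) \<in> parcs G \<and> bootstrap G \<theta> w j u}"
    by (auto simp: bootstrap_def bootstrap_step_def sum_of_bool_arcs[OF G])
  then show ?case
  proof cases
    case 1
    then show ?thesis using Suc by blast
  next
    case 2
    have "{u. (u, v) \<in> parcs G \<and> bootstrap G \<theta> w j u} \<subseteq> {u. (u, v) \<in> parcs G \<and> C u}"
      using Suc.IH G unfolding pair_graph_iff by blast
    then have "\<theta> \<le> card {u. (u, v) \<in> parcs G \<and> C u}"
      using 2 card_mono[OF fin] le_trans by blast
    then show ?thesis using C Suc.prems(1) unfolding perc_closed_def by blast
  qed
qed

lemma perc_closed_bootstrap_limit:
  assumes G: "pair_graph G"
  shows "perc_closed G \<theta> (bootstrap_limit G \<theta> w)"
  unfolding perc_closed_def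
proof (intro ballI impI)
  fix v assume v: "v \<in> pverts G"
    and le: "\<theta> \<le> card {u. (u, v) \<in> parcs G \<and> bootstrap_limit G \<theta> w u}"
  let ?S = "{u. (u, v) \<in> parcs G \<and> bootstrap_limit G \<theta> w u}"
  have fin: "finite {u. (u, v) \<in> parcs G}"
    using G unfolding pair_graph_iff by (auto intro: finite_subset[of _ "pverts G"])
  have "\<forall>u\<in>?S. \<exists>j. bootstrap G \<theta> w j u"
    by (auto simp: bootstrap_limit_iff)
  then obtain J where J: "\<And>u. u \<in> ?S \<Longrightarrow> bootstrap G \<theta> w (J u) u"
    by metis
  have finS: "finite ?S" using fin by (rule rev_finite_subset) blast
  \<comment> \<open>The finitely many infected neighbours need a common infection time; the sum is
    an upper bound that also makes sense for an empty set.\<close>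
  define k where "k = (\<Sum>u\<in>?S. J u)"
  have Jk: "J u \<le> k" if "u \<in> ?S" for u
    unfolding k_def using that finS by (meson member_le_sum zero_le)
  have "?S \<subseteq> {u. (u, v) \<in> parcs G \<and> bootstrap G \<theta> w k u}"
  proof
    fix u assume u: "u \<in> ?S"
    have "bootstrap G \<theta> w k u" by (rule bootstrap_mono[OF Jk[OF u] J[OF u]])
    then show "u \<in> {u. (u, v) \<in> parcs G \<and> bootstrap G \<theta> w k u}" using u by blast
  qed
  then have "card ?S \<le> card {u. (u, v) \<in> parcs G \<and> bootstrap G \<theta> w k u}"
    by (rule card_mono[rotated]) (rule rev_finite_subset[OF fin], blast)
  with le have "bootstrap G \<theta> w (Suc k) v"
    by (simp add: bootstrap_def bootstrap_step_def sum_of_bool_arcs[OF G])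
  then show "bootstrap_limit G \<theta> w v"
    by (auto simp: bootstrap_limit_iff)
qed

text \<open>The limit is the least closed configuration above \<open>w\<close>. Growth can therefore
  be proved for an arbitrary closed superset, without following time steps, and blocking by
  exhibiting one closed superset that is not full.\<close>

lemma Span_iff_closed:
  assumes G: "pair_graph G"
  shows "w \<in> Span G \<theta> \<longleftrightarrow>
    (\<forall>C. perc_closed G \<theta> C \<and> (\<forall>v\<in>pverts G. w v \<longrightarrow> C v) \<longrightarrow> (\<forall>v\<in>pverts G. C v))"
proof
  assume "w \<in> Span G \<theta>"
  then show "\<forall>C. perc_closed G \<theta> C \<and> (\<forall>v\<in>pverts G. w v \<longrightarrow> C v) \<longrightarrow> (\<forall>v\<in>pverts G. C v)"
    using bootstrap_subset_closed[OF G] unfolding Span_def bootstrap_limit_iff by blast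
next
  assume R: "\<forall>C. perc_closed G \<theta> C \<and> (\<forall>v\<in>pverts G. w v \<longrightarrow> C v) \<longrightarrow> (\<forall>v\<in>pverts G. C v)"
  have "w v \<Longrightarrow> bootstrap_limit G \<theta> w v" for v
    unfolding bootstrap_limit_iff by (intro exI[of _ 0]) (simp add: bootstrap_def)
  then show "w \<in> Span G \<theta>"
    using R perc_closed_bootstrap_limit[OF G] unfolding Span_def by blast
qed

section \<open>Neighbourhoods in the product of a cycle and two cliques\<close>

lemma pair_graph_clique: "pair_graph (clique_graph n)"
  by (auto simp: pair_graph_iff clique_graph_def)

lemma pair_graph_cyc_cliques: "pair_graph (cyc_cliques m n)"
  unfolding cyc_cliques_def
  by (intro pair_graph_cartesian_product pair_graph_cycle_graph pair_graph_clique)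

lemma pverts_cyc_cliques: "pverts (cyc_cliques m n) = {..<m} \<times> {..<n} \<times> {..<n}"
  by (simp add: cyc_cliques_def cartesian_product_def cycle_graph_def clique_graph_def)

lemma site_in_pverts [simp]:
  "site b i x y \<in> pverts (cyc_cliques m n) \<longleftrightarrow> i < m \<and> x < n \<and> y < n"
  by (auto simp: pverts_cyc_cliques site_def)

lemma site_eq_iff [simp]: "site b i x y = site b j x' y' \<longleftrightarrow> i = j \<and> x = x' \<and> y = y'"
  by (auto simp: site_def)

lemma site_Not: "site (\<not> b) i x y = site b i y x"
  by (auto simp: site_def)

lemma pverts_cyc_cliquesE:
  assumes "v \<in> pverts (cyc_cliques m n)"
  obtains i x y where "v = site b i x y" "i < m" "x < n" "y < n"
  using assms by (cases v; cases b) (auto simp: pverts_cyc_cliques site_def)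

lemma arc_cyc_cliques_iff:
  "(site b j x' y', site b i x y) \<in> parcs (cyc_cliques m n) \<longleftrightarrow>
     j < m \<and> i < m \<and> x < n \<and> y < n \<and> x' < n \<and> y' < n \<and>
     ((i = j \<and> x = x' \<and> y \<noteq> y') \<or> (i = j \<and> y = y' \<and> x \<noteq> x') \<or> (cyc_adj m i j \<and> x = x' \<and> y = y'))"
  unfolding cyc_cliques_def cartesian_product_def cycle_graph_def clique_graph_def
    cyc_adj_def site_def by (cases b) auto

text \<open>A healthy site does not contribute to the counts of its own row and column, so the two
  lines and the transversal give disjoint sets and their sizes simply add up.\<close>

lemma neighbour_count:
  assumes "i < m" "x < n" "y < n" "\<not> C (site b i x y)"
  shows "card {u. (u, site b i x y) \<in> parcs (cyc_cliques m n) \<and> C u} =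
    line_count n b C i x + line_count n (\<not> b) C i y + adj_count m b C i x y"
proof -
  let ?A = "site b i x ` {y'. y' < n \<and> C (site b i x y')}"
  let ?B = "(\<lambda>x'. site b i x' y) ` {x'. x' < n \<and> C (site (\<not> b) i y x')}"
  let ?D = "(\<lambda>j. site b j x y) ` {j. j < m \<and> cyc_adj m i j \<and> C (site b j x y)}"
  have eq: "{u. (u, site b i x y) \<in> parcs (cyc_cliques m n) \<and> C u} = ?A \<union> ?B \<union> ?D"
  proof (rule Set.set_eqI)
    fix u
    obtain j x' y' where u: "u = site b j x' y'"
      by (cases u; cases b) (auto simp: site_def)
    have "(u, site b i x y) \<in> parcs (cyc_cliques m n) \<and> C u \<longleftrightarrow> u \<in> ?A \<union> ?B \<union> ?D"
      unfolding u arc_cyc_cliques_iff using assms by (auto simp: site_Not)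
    then show "u \<in> {u. (u, site b i x y) \<in> parcs (cyc_cliques m n) \<and> C u} \<longleftrightarrow> u \<in> ?A \<union> ?B \<union> ?D"
      by blast
  qed
  have d1: "?A \<inter> ?B = {}" using assms(4) by (auto simp: site_Not)
  have d2: "(?A \<union> ?B) \<inter> ?D = {}" by (auto simp: cyc_adj_def)
  have c: "card ?A = line_count n b C i x" "card ?B = line_count n (\<not> b) C i y"
    "card ?D = adj_count m b C i x y"
    unfolding line_count_def adj_count_def by (intro card_image inj_onI; simp)+
  have f: "finite ?A" "finite ?B" "finite ?D" by auto
  show ?thesis
    unfolding eq using d1 d2 c f by (simp add: card_Un_disjoint)
qed

lemma line_count_mono:
  assumes "\<And>y. y < n \<Longrightarrow> C (site b i x y) \<Longrightarrow> D (site b i x y)"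
  shows "line_count n b C i x \<le> line_count n b D i x"
  unfolding line_count_def by (rule card_mono) (use assms in auto)

lemma card_le_line_count:
  assumes "Y \<subseteq> {..<n}" "\<And>y. y \<in> Y \<Longrightarrow> C (site b i x y)"
  shows "card Y \<le> line_count n b C i x"
  unfolding line_count_def by (rule card_mono) (use assms in auto)

text \<open>For an already infected site, where \<open>neighbour_count\<close> does not apply, the
  conclusion is trivial; so the criterion holds at every site.\<close>

lemma closed_siteI:
  assumes C: "perc_closed (cyc_cliques m n) \<theta> C" and "i < m" "x < n" "y < n"
    and le: "\<theta> \<le> line_count n b C i x + line_count n (\<not> b) C i y + adj_count m b C i x y"
  shows "C (site b i x y)"
proof (rule ccontr)
  assume not: "\<not> C (site b i x y)"
  have "\<theta> \<le> card {u. (u, site b i x y) \<in> parcs (cyc_cliques m n) \<and> C u}"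
    using le neighbour_count[of i m x n y C b, OF assms(2-4) not] by simp
  then show False
    using C not assms(2-4) unfolding perc_closed_def by (meson site_in_pverts)
qed

lemma closed_line_full:
  assumes C: "perc_closed (cyc_cliques m n) \<theta> C" and "i < m" "x < n" "y < n"
    and "\<theta> \<le> line_count n b C i x"
  shows "C (site b i x y)"
  using closed_siteI[OF assms(1-4)] assms(5) by simp

text \<open>An infected grid with \<theta> rows and \<theta> columns first fills its own rows, and
  these then fill every line across them.\<close>

lemma closed_plane_full:
  assumes C: "perc_closed (cyc_cliques m n) \<theta> C" and i: "i < m"
    and X: "X \<subseteq> {..<n}" "\<theta> \<le> card X" and Y: "Y \<subseteq> {..<n}" "\<theta> \<le> card Y"
    and XY: "\<And>x y. x \<in> X \<Longrightarrow> y \<in> Y \<Longrightarrow> C (site b i x y)"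
    and xy: "x < n" "y < n"
  shows "C (site b i x y)"
proof -
  have "C (site (\<not> b) i y' x')" if "x' \<in> X" "y' < n" for x' y'
  proof -
    have "\<theta> \<le> line_count n b C i x'"
      using card_le_line_count[OF Y(1)] XY that(1) Y(2) le_trans by blast
    then show ?thesis
      using closed_line_full[OF C i] that X(1) unfolding site_Not by blast
  qed
  then have "card X \<le> line_count n (\<not> b) C i y"
    using xy by (intro card_le_line_count[OF X(1)])
  then have "\<theta> \<le> line_count n (\<not> b) C i y"
    using X(2) by simp
  then show ?thesis
    using closed_line_full[of m n \<theta> C i y x "\<not> b", OF C i xy(2) xy(1)] by (simp add: site_Not)
qed

section \<open>Growth: good planes and nuclei\<close>

definition good_plane :: "nat \<Rightarrow> nat \<Rightarrow> nat \<Rightarrow> (nat \<times> nat \<times> nat \<Rightarrow> bool) \<Rightarrow> nat \<Rightarrow> bool" where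
  "good_plane n l K w i \<longleftrightarrow> (\<forall>b. K \<le> card {x. x < n \<and> l \<le> line_count n b w i x})"

text \<open>Where a row and a column with \<open>l\<close> sites cross, the full neighbouring plane
  supplies the one missing neighbour. These crossings form a grid that fills the plane.\<close>

lemma good_plane_spread:
  assumes C: "perc_closed (cyc_cliques m n) (2 * l + 1) C"
    and w: "\<And>v. v \<in> pverts (cyc_cliques m n) \<Longrightarrow> w v \<Longrightarrow> C v"
    and ij: "i < m" "j < m" "cyc_adj m i j"
    and good: "good_plane n l (2 * l + 1) w i"
    and full: "\<And>x y. x < n \<Longrightarrow> y < n \<Longrightarrow> C (site True j x y)"
    and xy: "x < n" "y < n"
  shows "C (site True i x y)"
proof -
  let ?X = "\<lambda>b. {x. x < n \<and> l \<le> line_count n b w i x}"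
  have card: "2 * l + 1 \<le> card (?X b)" for b
    using good unfolding good_plane_def by blast
  have wC: "line_count n b w i x \<le> line_count n b C i x" if "x < n" for b x
    using w ij(1) that by (intro line_count_mono) simp
  have "C (site True i x y)" if "x \<in> ?X True" "y \<in> ?X False" for x y
  proof (rule closed_siteI[OF C ij(1)])
    have "adj_count m True C i x y \<ge> card {j}"
      unfolding adj_count_def by (rule card_mono) (use ij full that in auto)
    then show "2 * l + 1 \<le> line_count n True C i x + line_count n (\<not> True) C i y + adj_count m True C i x y"
      using wC[of x True] wC[of y False] that by simp
  qed (use that in auto)
  then show ?thesis
    by (intro closed_plane_full[OF C ij(1) _ card[of True] _ card[of False] _ xy]) auto
qed

text \<open>The nucleus grows along the columns with \<open>l\<close> sites, as (l + 1) + l is the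
  threshold, and becomes a full row. This row gives most of those columns an extra site, so that
  they act as nuclei towards the rows with \<open>l\<close> sites. The constant 3l + 2 is 2l + 1
  plus the l + 1 columns that met the row in an initially infected site.\<close>

lemma nucleus_fills_plane:
  assumes C: "perc_closed (cyc_cliques m n) (2 * l + 1) C"
    and w: "\<And>v. v \<in> pverts (cyc_cliques m n) \<Longrightarrow> w v \<Longrightarrow> C v"
    and i: "i < m" and x0: "x0 < n" "line_count n b w i x0 = l + 1"
    and good: "good_plane n l (3 * l + 2) w i"
    and xy: "x < n" "y < n"
  shows "C (site b i x y)"
proof -
  let ?X = "\<lambda>b. {x. x < n \<and> l \<le> line_count n b w i x}"
  have card: "3 * l + 2 \<le> card (?X b)" for b
    using good unfolding good_plane_def by blast
  have wC: "line_count n b w i x \<le> line_count n b C i x" if "x < n" for b x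
    using w i that by (intro line_count_mono) simp
  have "C (site b i x0 y)" if "y \<in> ?X (\<not> b)" for y
    using wC[of x0 b] wC[of y "\<not> b"] that x0 i by (intro closed_siteI[OF C]) auto
  then have "card (?X (\<not> b)) \<le> line_count n b C i x0"
    by (intro card_le_line_count) auto
  then have row: "C (site b i x0 y)" if "y < n" for y
    using card[of "\<not> b"] that by (intro closed_line_full[OF C i x0(1)]) auto
  \<comment> \<open>Columns whose crossing point with row \<open>x0\<close> is newly infected; at most \<open>l + 1\<close> columns are lost.\<close>
  let ?Y = "?X (\<not> b) - {y. y < n \<and> w (site b i x0 y)}"
  have "card (?X (\<not> b)) - card {y. y < n \<and> w (site b i x0 y)} \<le> card ?Y"
    by (rule diff_card_le_card_Diff) simp
  then have cardY: "2 * l + 1 \<le> card ?Y"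
    using x0(2) card[of "\<not> b"] unfolding line_count_def by simp
  have col: "l + 1 \<le> line_count n (\<not> b) C i y" if y: "y \<in> ?Y" for y
  proof -
    have "card (insert x0 {x. x < n \<and> w (site (\<not> b) i y x)}) \<le> line_count n (\<not> b) C i y"
    proof (rule card_le_line_count)
      show "insert x0 {x. x < n \<and> w (site (\<not> b) i y x)} \<subseteq> {..<n}" using x0 by blast
      fix x assume "x \<in> insert x0 {x. x < n \<and> w (site (\<not> b) i y x)}"
      then show "C (site (\<not> b) i y x)"
      proof
        assume "x = x0"
        then show ?thesis using row[of y] y by (simp add: site_Not)
      next
        assume "x \<in> {x. x < n \<and> w (site (\<not> b) i y x)}"
        then show ?thesis using w i y by simp
      qed
    qed
    moreover have "card (insert x0 {x. x < n \<and> w (site (\<not> b) i y x)}) = Suc (line_count n (\<not> b) w i y)"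
      unfolding line_count_def using y by (subst card_insert_disjoint) (auto simp: site_Not)
    ultimately show ?thesis using y by simp
  qed
  have "C (site b i x y)" if "x \<in> ?X b" "y \<in> ?Y" for x y
    using that wC[of x b] col[of y] i by (intro closed_siteI[OF C]) auto
  then show ?thesis
    using card[of b] by (intro closed_plane_full[OF C i _ _ _ cardY _ xy, of "?X b"]) auto
qed

text \<open>Excluding lines with l + 2 sites makes the nucleus have exactly l + 1 sites, which
  limits the columns lost in \<open>nucleus_fills_plane\<close>; goodness of all planes then carries
  the infection around the cycle.\<close>

lemma nucleus_spans:
  assumes m: "3 \<le> m" and i: "i < m" and x0: "x0 < n" "l + 1 \<le> line_count n b w i x0"
    and no: "\<And>i x b. i < m \<Longrightarrow> x < n \<Longrightarrow> line_count n b w i x < l + 2"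
    and good: "\<And>i. i < m \<Longrightarrow> good_plane n l (3 * l + 2) w i"
  shows "w \<in> Span (cyc_cliques m n) (2 * l + 1)"
  unfolding Span_iff_closed[OF pair_graph_cyc_cliques]
proof (intro allI impI ballI)
  fix C v
  assume C: "perc_closed (cyc_cliques m n) (2 * l + 1) C \<and> (\<forall>v\<in>pverts (cyc_cliques m n). w v \<longrightarrow> C v)"
    and v: "v \<in> pverts (cyc_cliques m n)"
  have cl: "perc_closed (cyc_cliques m n) (2 * l + 1) C"
    and wC: "\<And>v. v \<in> pverts (cyc_cliques m n) \<Longrightarrow> w v \<Longrightarrow> C v" using C by auto
  have "line_count n b w i x0 = l + 1" using x0(2) no[OF i x0(1), of b] by simp
  then have start: "C (site b i x y)" if "x < n" "y < n" for x y
    using nucleus_fills_plane[OF cl wC i x0(1) _ good[OF i] that] by blast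
  have start': "C (site True i x y)" if "x < n" "y < n" for x y
    using start[OF that] start[OF that(2) that(1)] site_Not[of True i y x] by (cases b) auto
  have good': "good_plane n l (2 * l + 1) w i" if "i < m" for i
  proof -
    have "3 * l + 2 \<ge> 2 * l + (1::nat)" by simp
    then show ?thesis using good[OF that] unfolding good_plane_def by (meson le_trans)
  qed
  have all: "C (site True ((i + k) mod m) x y)" if "x < n" "y < n" for k x y
    using that
  proof (induction k arbitrary: x y)
    case 0
    then show ?case using start' i by simp
  next
    case (Suc k)
    let ?j = "(i + k) mod m"
    have s: "(i + Suc k) mod m = (?j + 1) mod m" by (simp add: mod_Suc_eq)
    have jm: "?j < m" "(?j + 1) mod m < m" using m by simp_all
    have "(?j + 1) mod m \<noteq> ?j"
    proof (cases "?j + 1 < m")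
      case False
      then have "?j + 1 = m" using jm(1) by linarith
      then show ?thesis using m by simp
    qed simp
    then have adj: "cyc_adj m ((?j + 1) mod m) ?j" unfolding cyc_adj_def by simp
    show ?case unfolding s
      using good_plane_spread[OF cl wC jm(2) jm(1) adj good'[OF jm(2)] Suc.IH Suc.prems] by simp
  qed
  obtain j x y where j: "v = site True j x y" "j < m" "x < n" "y < n"
    using pverts_cyc_cliquesE[OF v] by metis
  \<comment> \<open>As i < m, walking m - i + j steps from plane \<open>i\<close> ends at m + j,
    that is at \<open>j\<close>.\<close>
  have "(i + (m - i + j)) mod m = j" using i j by simp
  then show "C v" using all[of x y "m - i + j"] j by simp
qed

section \<open>Blocking: crosses and protected arcs\<close>

lemma cyc_adj_cases:
  assumes "cyc_adj m i j" "i < m" "j < m"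
  shows "j = (i + 1) mod m \<or> j = (if i = 0 then m - 1 else i - 1)"
proof -
  have "j = i - 1 \<and> i \<noteq> 0 \<or> i = 0 \<and> j = m - 1" if "i = (j + 1) mod m"
  proof (cases "j + 1 < m")
    case True
    then show ?thesis using that by simp
  next
    case False
    then have "j + 1 = m" using assms by simp
    then show ?thesis using that by simp
  qed
  then show ?thesis using assms(1) unfolding cyc_adj_def by auto
qed

lemma cyc_adj_interior:
  assumes "cyc_adj m i j" "0 < i" "i + 1 < m" "j < m"
  shows "j = i + 1 \<or> j = i - 1"
  using cyc_adj_cases[OF assms(1) _ assms(4)] assms(2,3) by simp

lemma adj_count_le: 
  assumes "i < m"
  shows "adj_count m b C i x y \<le> 2"
proof -
  have "{j. j < m \<and> cyc_adj m i j \<and> C (site b j x y)} \<subseteq> {(i + 1) mod m, if i = 0 then m - 1 else i - 1}"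
    using cyc_adj_cases assms by blast
  from card_mono[OF _ this] show ?thesis
    unfolding adj_count_def by (rule order_trans) (auto simp: card_insert_if)
qed

text \<open>Witness of a site with many infected neighbours, the sets \<open>S\<close>, \<open>T\<close> lying on the two lines through it and
  \<open>Z\<close> on the transversal; the site itself is only allowed to belong to \<open>Z\<close>.\<close>

definition cross :: "nat \<Rightarrow> nat \<Rightarrow> (nat \<times> nat \<times> nat \<Rightarrow> bool) \<Rightarrow> nat \<Rightarrow> nat \<Rightarrow> nat \<Rightarrow> nat \<Rightarrow> bool" where
  "cross m n w i k1 k2 k3 \<longleftrightarrow> (\<exists>b x y S T Z. x < n \<and> y < n \<and> S \<subseteq> {..<n} - {y} \<and> card S = k1 \<and>
     T \<subseteq> {..<n} - {x} \<and> card T = k2 \<and> Z \<subseteq> {j. j < m \<and> (j = i \<or> cyc_adj m i j)} \<and> card Z = k3 \<and>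
     (\<forall>y'\<in>S. w (site b i x y')) \<and> (\<forall>x'\<in>T. w (site b i x' y)) \<and> (\<forall>j\<in>Z. w (site b j x y)))"

text \<open>Sizes are cut down to exact values so that a cross is a fixed number of sites, as the
  union bound requires. Health of the site keeps \<open>S\<close> and \<open>T\<close> away from
  it.\<close>

lemma crossI:
  assumes "x < n" "y < n" "k1 \<le> line_count n b w i x" "k2 \<le> line_count n (\<not> b) w i y"
    "k3 \<le> adj_count m b w i x y" "\<not> w (site b i x y)"
  shows "cross m n w i k1 k2 k3"
proof -
  obtain S where S: "S \<subseteq> {y. y < n \<and> w (site b i x y)}" "card S = k1"
    using assms(3) unfolding line_count_def by (meson obtain_subset_with_card_n)
  obtain T where T: "T \<subseteq> {x'. x' < n \<and> w (site (\<not> b) i y x')}" "card T = k2"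
    using assms(4) unfolding line_count_def by (meson obtain_subset_with_card_n)
  obtain Z where Z: "Z \<subseteq> {j. j < m \<and> cyc_adj m i j \<and> w (site b j x y)}" "card Z = k3"
    using assms(5) unfolding adj_count_def by (meson obtain_subset_with_card_n)
  have "S \<subseteq> {..<n} - {y}" "T \<subseteq> {..<n} - {x}" "Z \<subseteq> {j. j < m \<and> (j = i \<or> cyc_adj m i j)}"
    using S T Z assms(6) by (auto simp: site_Not)
  moreover have "\<forall>y'\<in>S. w (site b i x y')" "\<forall>x'\<in>T. w (site b i x' y)" "\<forall>j\<in>Z. w (site b j x y)"
    using S T Z by (auto simp: site_Not)
  ultimately show ?thesis
    unfolding cross_def using assms(1,2) S(2) T(2) Z(2) by blast
qed

text \<open>Needed for inclusion-exclusion between rows and columns. An infected crossing site is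
  counted by both lines, so it is removed from each and kept once in \<open>Z\<close>, leaving 2l +
  1 distinct sites; a healthy one leaves 2l + 2.\<close>

lemma cross_of_two_lines:
  assumes "i < m" "x < n" "y < n" "l + 1 \<le> line_count n True w i x" "l + 1 \<le> line_count n False w i y"
  shows "cross m n w i l l 1 \<or> cross m n w i (l + 1) (l + 1) 0"
proof (cases "w (site True i x y)")
  case False
  have "cross m n w i (l + 1) (l + 1) 0"
    using crossI[of x n y "l + 1" True w i "l + 1" 0 m, OF assms(2,3,4) _ _ False] assms(5) by simp
  then show ?thesis ..
next
  case True
  have "l \<le> card ({y'. y' < n \<and> w (site True i x y')} - {y})"
    using assms(4) True assms(3) unfolding line_count_def by (subst card_Diff_singleton) auto
  then obtain S where S: "S \<subseteq> {y'. y' < n \<and> w (site True i x y')} - {y}" "card S = l"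
    by (meson obtain_subset_with_card_n)
  have "l \<le> card ({x'. x' < n \<and> w (site False i y x')} - {x})"
    using assms(5) True assms(2) site_Not[of True i y x] unfolding line_count_def
    by (subst card_Diff_singleton) auto
  then obtain T where T: "T \<subseteq> {x'. x' < n \<and> w (site False i y x')} - {x}" "card T = l"
    by (meson obtain_subset_with_card_n)
  have "S \<subseteq> {..<n} - {y}" "T \<subseteq> {..<n} - {x}" using S T by auto
  moreover have "\<forall>y'\<in>S. w (site True i x y')" "\<forall>x'\<in>T. w (site True i x' y)"
    using S T site_Not[of True i y] by auto
  moreover have "{i} \<subseteq> {j. j < m \<and> (j = i \<or> cyc_adj m i j)}" "card {i} = 1"
    "\<forall>j\<in>{i}. w (site True j x y)" using assms(1) True by auto
  ultimately have "cross m n w i l l 1"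
    unfolding cross_def using assms(2,3) S(2) T(2) by blast
  then show ?thesis ..
qed

text \<open>The initial configuration is already closed: with at most \<open>l\<close> sites on each
  line and at most two transversal neighbours, reaching 2l + 1 forces one of the two crosses, up to
  exchanging rows and columns. As l < n, it is not full.\<close>

lemma not_Span_without_nucleus:
  assumes m: "0 < m" and n: "l < n"
    and no: "\<And>i x b. i < m \<Longrightarrow> x < n \<Longrightarrow> line_count n b w i x \<le> l"
    and c1: "\<And>i. i < m \<Longrightarrow> \<not> cross m n w i l l 1"
    and c2: "\<And>i. i < m \<Longrightarrow> \<not> cross m n w i (l - 1) l 2"
  shows "w \<notin> Span (cyc_cliques m n) (2 * l + 1)"
proof
  assume "w \<in> Span (cyc_cliques m n) (2 * l + 1)"
  have "perc_closed (cyc_cliques m n) (2 * l + 1) w"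
    unfolding perc_closed_def
  proof (intro ballI impI, rule ccontr)
    fix v assume v: "v \<in> pverts (cyc_cliques m n)" 
      and le: "2 * l + 1 \<le> card {u. (u, v) \<in> parcs (cyc_cliques m n) \<and> w u}" and nw: "\<not> w v"
    obtain i x y where v': "v = site True i x y" "i < m" "x < n" "y < n"
      using pverts_cyc_cliquesE[OF v] by metis
    let ?r = "line_count n True w i x" and ?c = "line_count n False w i y"
      and ?a = "adj_count m True w i x y"
    have sum: "2 * l + 1 \<le> ?r + ?c + ?a"
      using le neighbour_count[OF v'(2-4), of w True] nw unfolding v'(1) by simp
    have rc: "?r \<le> l" "?c \<le> l" "?a \<le> 2" using no v' adj_count_le by auto
    have nw': "\<not> w (site True i x y)" "\<not> w (site False i y x)"
      using nw v' site_Not[of True i y x] by auto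
    have ac: "adj_count m False w i y x = ?a" unfolding adj_count_def using site_Not[of True _ y x] by simp
    consider "?r = l" "?c = l" "1 \<le> ?a" | "l - 1 \<le> ?r" "?c = l" "?a = 2" | "l - 1 \<le> ?c" "?r = l" "?a = 2"
      using sum rc by linarith
    then show False
    proof cases
      case 1
      then show False using crossI[of x n y l True w i l 1 m, OF v'(3,4) _ _ _ nw'(1)] c1[OF v'(2)] by simp
    next
      case 2
      then show False using crossI[of x n y "l - 1" True w i l 2 m, OF v'(3,4) _ _ _ nw'(1)] c2[OF v'(2)] by simp
    next
      case 3
      then show False using crossI[of y n x "l - 1" False w i l 2 m, OF v'(4,3) _ _ _ nw'(2)] c2[OF v'(2)] ac by simp
    qed
  qed
  then have "\<And>v. v \<in> pverts (cyc_cliques m n) \<Longrightarrow> w v"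
    using \<open>w \<in> Span _ _\<close> unfolding Span_iff_closed[OF pair_graph_cyc_cliques] by blast
  then have "card {..<n} \<le> line_count n True w 0 0"
    using m n by (intro card_le_line_count) auto
  then show False using no[of 0 0 True] m n by simp
qed

text \<open>Two planes without lines of \<open>l\<close> infected sites protect the arc between them, even when
  everything outside the arc is infected.\<close>

lemma not_Span_blocked:
  assumes B: "0 < B1" "B1 < B2" "B2 + 1 < m" and n: "l \<le> n" "1 \<le> l"
    and no: "\<And>i x b. B1 \<le> i \<Longrightarrow> i \<le> B2 \<Longrightarrow> x < n \<Longrightarrow> line_count n b w i x \<le> l"
    and block: "\<And>x. x < n \<Longrightarrow> line_count n True w B1 x < l" "\<And>x. x < n \<Longrightarrow> line_count n True w B2 x < l"
    and c: "\<And>i. B1 \<le> i \<Longrightarrow> i \<le> B2 \<Longrightarrow> \<not> cross m n w i (l - 1) l 1"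
  shows "w \<notin> Span (cyc_cliques m n) (2 * l + 1)"
proof
  assume "w \<in> Span (cyc_cliques m n) (2 * l + 1)"
  define C where "C v = (w v \<or> \<not> (B1 \<le> fst v \<and> fst v \<le> B2))" for v
  have fst_site [simp]: "fst (site b i x y) = i" for b i x y by (simp add: site_def)
  have "perc_closed (cyc_cliques m n) (2 * l + 1) C"
    unfolding perc_closed_def
  proof (intro ballI impI, rule ccontr)
    fix v assume v: "v \<in> pverts (cyc_cliques m n)" 
      and le: "2 * l + 1 \<le> card {u. (u, v) \<in> parcs (cyc_cliques m n) \<and> C u}" and nC: "\<not> C v"
    obtain i x y where v': "v = site True i x y" "i < m" "x < n" "y < n"
      using pverts_cyc_cliquesE[OF v] by metis
    have i: "B1 \<le> i" "i \<le> B2" and nw: "\<not> w (site True i x y)"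
      using nC unfolding C_def v' by auto
    let ?r = "line_count n True w i x" and ?c = "line_count n False w i y"
    have lc: "line_count n b C i x = line_count n b w i x" for b x
      unfolding line_count_def C_def using i by simp
    have sum: "2 * l + 1 \<le> ?r + ?c + adj_count m True C i x y"
      using le neighbour_count[OF v'(2-4), of C True] nC unfolding v'(1) by (simp add: lc)
    have rc: "?r \<le> l" "?c \<le> l" using no v' i by auto
    have a2: "adj_count m True C i x y \<le> 2" using adj_count_le v' by blast
    \<comment> \<open>At most two neighbours are transversal, so the lines supply at least 2l - 1,
      and a transversal neighbour infected in \<open>w\<close> would complete an excluded cross. All
      transversal help has to come from outside the arc.\<close>
    have a1: "adj_count m True w i x y = 0"
    proof (rule ccontr)
      assume a1: "adj_count m True w i x y \<noteq> 0"
      have "l - 1 \<le> ?r" "l \<le> ?c \<or> l \<le> ?r \<and> l - 1 \<le> ?c"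
        using sum rc a2 by linarith+
      then consider "l - 1 \<le> ?r" "l \<le> ?c" | "l \<le> ?r" "l - 1 \<le> ?c" by blast
      then show False
      proof cases
        case 1
        then show False using crossI[of x n y "l - 1" True w i l 1 m, OF v'(3,4) _ _ _ nw] c[OF i] a1 by simp
      next
        case 2
        have nw': "\<not> w (site False i y x)" using nw site_Not[of True i y x] by simp
        have ac: "adj_count m False w i y x = adj_count m True w i x y"
          unfolding adj_count_def using site_Not[of True _ y x] by simp
        show False using 2 crossI[of y n x "l - 1" False w i l 1 m, OF v'(4,3) _ _ _ nw'] c[OF i] a1 ac by simp
      qed
    qed
    show False
    proof (cases "B1 < i \<and> i < B2")
      case True
      have "adj_count m True C i x y = adj_count m True w i x y"
      proof -
        have "C (site True j x y) = w (site True j x y)" if "cyc_adj m i j" "j < m" for j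
          using cyc_adj_interior[OF that(1) _ _ that(2)] True B i unfolding C_def by auto
        then show ?thesis unfolding adj_count_def by meson
      qed
      then show False using a1 sum rc by simp
    next
      case False
      \<comment> \<open>A boundary plane has at most one neighbouring plane outside the arc, because
        B1 < B2. The short row offsets it: (l - 1) + l + 1 = 2l.\<close>
      then have r: "?r < l" using block v' i by (metis le_neq_implies_less)
      have "{j. j < m \<and> cyc_adj m i j \<and> C (site True j x y)} \<subseteq>
          {j. j < m \<and> cyc_adj m i j \<and> w (site True j x y)} \<union> {if i = B1 then B1 - 1 else B2 + 1}"
      proof
        fix j assume "j \<in> {j. j < m \<and> cyc_adj m i j \<and> C (site True j x y)}"
        then have j: "j < m" "cyc_adj m i j" "C (site True j x y)" by auto
        have jj: "j = i + 1 \<or> j = i - 1"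
          using cyc_adj_interior[OF j(2) _ _ j(1)] i B by simp
        have ii: "i = B1 \<or> i = B2" using False i by auto
        show "j \<in> {j. j < m \<and> cyc_adj m i j \<and> w (site True j x y)} \<union> {if i = B1 then B1 - 1 else B2 + 1}"
        proof (cases "B1 \<le> j \<and> j \<le> B2")
          case True
          then show ?thesis using j unfolding C_def by simp
        next
          case False
          then have "j = (if i = B1 then B1 - 1 else B2 + 1)"
            using jj ii B by (cases "i = B1") auto
          then show ?thesis by simp
        qed
      qed
      from card_mono[OF _ this] have "adj_count m True C i x y \<le>
          card ({j. j < m \<and> cyc_adj m i j \<and> w (site True j x y)} \<union> {if i = B1 then B1 - 1 else B2 + 1})"
        unfolding adj_count_def by simp
      also have "\<dots> \<le> adj_count m True w i x y + card {if i = B1 then B1 - 1 else B2 + 1}"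
        unfolding adj_count_def by (rule card_Un_le)
      finally have "adj_count m True C i x y \<le> 1" using a1 by simp
      then show False using sum rc r by simp
    qed
  qed
  then have all: "\<And>v. v \<in> pverts (cyc_cliques m n) \<Longrightarrow> C v"
    using \<open>w \<in> Span _ _\<close> unfolding Span_iff_closed[OF pair_graph_cyc_cliques] C_def by blast
  have "card {..<n} \<le> line_count n True w B1 0"
  proof (rule card_le_line_count)
    fix y assume "y \<in> {..<n}"
    then have "C (site True B1 0 y)" using all B n by simp
    then show "w (site True B1 0 y)" unfolding C_def using B by simp
  qed simp
  then show False using block(1)[of 0] n by simp
qed


section \<open>Independent blocks of sites\<close>

definition determined_by :: "'v set \<Rightarrow> (('v \<Rightarrow> bool) \<Rightarrow> 'b) \<Rightarrow> bool" where
  "determined_by A f \<longleftrightarrow> (\<forall>w w'. (\<forall>v\<in>A. w v = w' v) \<longrightarrow> f w = f w')"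

abbreviation bern :: "'v set \<Rightarrow> real \<Rightarrow> ('v \<Rightarrow> bool) pmf" where
  "bern V p \<equiv> Pi_pmf V False (\<lambda>_. bernoulli_pmf p)"

text \<open>The default value \<open>False\<close> outside \<open>V\<close> leaves finitely many
  configurations, so every real function of the configuration is integrable.\<close>

lemma finite_set_pmf_bern: "finite V \<Longrightarrow> finite (set_pmf (bern V p))"
  by (rule finite_subset[OF set_Pi_pmf_subset']) (auto intro!: finite_PiE_dflt)

lemma integrable_bern:
  fixes f :: "_ \<Rightarrow> real"
  shows "finite V \<Longrightarrow> integrable (measure_pmf (bern V p)) f"
  by (intro integrable_measure_pmf_finite finite_set_pmf_bern)

text \<open>Disjoint blocks of coordinates are independent. The form with expectations serves the
  exponential Markov inequality; probabilities follow by taking indicators.\<close>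

lemma expectation_prod_blocks:
  fixes f :: "'j \<Rightarrow> ('v \<Rightarrow> bool) \<Rightarrow> real"
  assumes V: "finite V" and J: "finite J" and A: "\<And>j. j \<in> J \<Longrightarrow> A j \<subseteq> V"
    and disj: "disjoint_family_on A J" and dep: "\<And>j. j \<in> J \<Longrightarrow> determined_by (A j) (f j)"
  shows "measure_pmf.expectation (bern V p) (\<lambda>w. \<Prod>j\<in>J. f j w) =
    (\<Prod>j\<in>J. measure_pmf.expectation (bern V p) (f j))"
proof -
  \<comment> \<open>A restriction to \<open>A j\<close> is undefined outside the block;
    \<open>Y j\<close> overwrites those values and so recovers \<open>f j\<close> from the
    restriction alone.\<close>
  define Y where "Y j g = f j (\<lambda>v. if v \<in> A j then g v else False)" for j and g :: "'v \<Rightarrow> bool"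
  have "prob_space.indep_vars (bern V p) (\<lambda>j. PiM (A j) (\<lambda>_. count_space UNIV)) (\<lambda>j w. restrict (\<lambda>i. w i) (A j)) J"
    by (rule prob_space.indep_vars_restrict[OF measure_pmf.prob_space_axioms indep_vars_Pi_pmf[OF V] A disj])
  then have "prob_space.indep_vars (bern V p) (\<lambda>_. borel) (\<lambda>j w. Y j (restrict (\<lambda>i. w i) (A j))) J"
  proof (rule prob_space.indep_vars_compose2[OF measure_pmf.prob_space_axioms])
    fix j assume j: "j \<in> J"
    have "PiM (A j) (\<lambda>_. count_space (UNIV :: bool set)) = count_space (PiE (A j) (\<lambda>_. UNIV))"
      using A[OF j] V by (intro count_space_PiM_finite) (auto intro: finite_subset)
    then show "Y j \<in> measurable (PiM (A j) (\<lambda>_. count_space UNIV)) borel"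
      by simp
  qed
  moreover have "Y j (restrict (\<lambda>i. w i) (A j)) = f j w" if "j \<in> J" for j w
    using dep[OF that] unfolding determined_by_def Y_def by auto
  ultimately have ind: "prob_space.indep_vars (bern V p) (\<lambda>_. borel) f J"
    by (subst prob_space.indep_vars_cong[OF measure_pmf.prob_space_axioms, where Y = "\<lambda>j w. Y j (restrict (\<lambda>i. w i) (A j))"]) auto
  show ?thesis
    by (rule prob_space.indep_vars_lebesgue_integral[OF measure_pmf.prob_space_axioms J ind]) (rule integrable_bern[OF V])
qed

lemma prob_blocks:
  fixes P :: "'j \<Rightarrow> ('v \<Rightarrow> bool) \<Rightarrow> bool"
  assumes V: "finite V" and J: "finite J" and A: "\<And>j. j \<in> J \<Longrightarrow> A j \<subseteq> V"
    and disj: "disjoint_family_on A J" and dep: "\<And>j. j \<in> J \<Longrightarrow> determined_by (A j) (P j)"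
  shows "measure_pmf.prob (bern V p) {w. \<forall>j\<in>J. P j w} =
    (\<Prod>j\<in>J. measure_pmf.prob (bern V p) {w. P j w})"
proof -
  have e: "measure_pmf.expectation (bern V p) (indicator S) = measure_pmf.prob (bern V p) S" for S
    by simp
  have prod: "indicator {w. \<forall>j\<in>J. P j w} = (\<lambda>w. \<Prod>j\<in>J. indicator {w. P j w} w :: real)"
    using J by (auto simp: fun_eq_iff indicator_def prod_zero_iff split: if_splits)
  have det: "determined_by (A j) (indicator {w. P j w} :: _ \<Rightarrow> real)" if "j \<in> J" for j
    unfolding determined_by_def
  proof (intro allI impI)
    fix w w' :: "'v \<Rightarrow> bool" assume "\<forall>v\<in>A j. w v = w' v"
    then have "P j w = P j w'" using dep[OF that] unfolding determined_by_def by blast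
    then show "indicator {w. P j w} w = (indicator {w. P j w} w' :: real)" by (simp add: indicator_def)
  qed
  have "measure_pmf.expectation (bern V p) (indicator {w. \<forall>j\<in>J. P j w} :: _ \<Rightarrow> real) =
     measure_pmf.expectation (bern V p) (\<lambda>w. \<Prod>j\<in>J. indicator {w. P j w} w :: real)"
    by (rule arg_cong[where f = "measure_pmf.expectation (bern V p)", OF prod])
  moreover have "measure_pmf.expectation (bern V p) (\<lambda>w. \<Prod>j\<in>J. indicator {w. P j w} w :: real) =
     (\<Prod>j\<in>J. measure_pmf.expectation (bern V p) (indicator {w. P j w} :: _ \<Rightarrow> real))"
    by (rule expectation_prod_blocks[where f = "\<lambda>j. indicator {w. P j w}", OF V J A disj det])
  ultimately show ?thesis by (simp only: e)
qed

section \<open>Number of infected sites in a block\<close>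

lemma prob_card_block:
  assumes "finite V" "A \<subseteq> V" "0 \<le> p" "p \<le> 1"
  shows "measure_pmf.prob (bern V p) {w. card {v \<in> A. w v} \<in> K} =
    measure_pmf.prob (binomial_pmf (card A) p) K"
proof -
  have A: "finite A" using assms finite_subset by blast
  have "binomial_pmf (card A) p = map_pmf (\<lambda>f. card {x\<in>A. f x}) (bern A p)"
    using assms A by (intro binomial_pmf_altdef') auto
  also have "bern A p = map_pmf (\<lambda>f x. if x \<in> A then f x else False) (bern V p)"
    using assms by (intro Pi_pmf_subset)
  finally show ?thesis
    by (simp add: vimage_def conj_commute cong: conj_cong)
qed

lemma prob_all:
  assumes "finite V" "A \<subseteq> V" "0 \<le> p" "p \<le> 1"
  shows "measure_pmf.prob (bern V p) {w. \<forall>v\<in>A. w v} = p ^ card A"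
proof -
  have A: "finite A" using assms finite_subset by blast
  have "(\<forall>v\<in>A. w v) \<longleftrightarrow> card {v \<in> A. w v} \<in> {card A}" for w
  proof
    assume "card {v \<in> A. w v} \<in> {card A}"
    then have "{v \<in> A. w v} = A" by (intro card_subset_eq[OF A]) auto
    then show "\<forall>v\<in>A. w v" by blast
  next
    assume "\<forall>v\<in>A. w v"
    then have "{v \<in> A. w v} = A" by blast
    then show "card {v \<in> A. w v} \<in> {card A}" by simp
  qed
  then show ?thesis
    using prob_card_block[OF assms, of "{card A}"] assms by (simp add: measure_pmf_single)
qed

text \<open>First-moment bound for events witnessed by \<open>k\<close> infected sites, used for
  lines and crosses alike. Different indices may give the same set, which only increases the
  bound.\<close>

lemma prob_Ex_all_le:
  assumes V: "finite V" and J: "finite J" and A: "\<And>j. j \<in> J \<Longrightarrow> A j \<subseteq> V \<and> card (A j) = k"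
    and p: "0 \<le> p" "p \<le> 1"
  shows "measure_pmf.prob (bern V p) {w. \<exists>j\<in>J. \<forall>v\<in>A j. w v} \<le> real (card J) * p ^ k"
proof -
  have "{w. \<exists>j\<in>J. \<forall>v\<in>A j. w v} = (\<Union>j\<in>J. {w. \<forall>v\<in>A j. w v})" by blast
  then have "measure_pmf.prob (bern V p) {w. \<exists>j\<in>J. \<forall>v\<in>A j. w v} \<le>
      (\<Sum>j\<in>J. measure_pmf.prob (bern V p) {w. \<forall>v\<in>A j. w v})"
    using measure_pmf.finite_measure_subadditive_finite[OF J, of "\<lambda>j. {w. \<forall>v\<in>A j. w v}"] by simp
  also have "\<dots> = (\<Sum>j\<in>J. p ^ k)"
  proof (rule sum.cong[OF refl])
    fix j assume "j \<in> J"
    then show "measure_pmf.prob (bern V p) {w. \<forall>v\<in>A j. w v} = p ^ k"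
      using A prob_all[of V "A j" p, OF V _ p] by simp
  qed
  finally show ?thesis by simp
qed

text \<open>Exponential Markov inequality, with \<open>t\<close> the exponentiated parameter.\<close>

lemma prob_few_blocks_le:
  assumes V: "finite V" and J: "finite J" and A: "\<And>j. j \<in> J \<Longrightarrow> A j \<subseteq> V"
    and disj: "disjoint_family_on A J" and dep: "\<And>j. j \<in> J \<Longrightarrow> determined_by (A j) (P j)"
    and r: "\<And>j. j \<in> J \<Longrightarrow> r \<le> measure_pmf.prob (bern V p) {w. P j w}"
    and t: "0 < t" "t \<le> 1"
  shows "measure_pmf.prob (bern V p) {w. card {j \<in> J. P j w} < K} \<le>
    (1 / t) ^ K * (1 - r * (1 - t)) ^ card J"
proof -
  let ?M = "measure_pmf (bern V p)"
  have pw: "t ^ card {j \<in> J. P j w} = (\<Prod>j\<in>J. if P j w then t else 1)" for w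
    using J by (simp add: prod.If_cases Int_def)
  have "measure ?M {w. card {j \<in> J. P j w} < K} =
      measure_pmf.expectation (bern V p) (indicator {w. card {j \<in> J. P j w} < K})"
    by simp
  also have "\<dots> \<le> measure_pmf.expectation (bern V p) (\<lambda>w. (1 / t) ^ K * t ^ card {j \<in> J. P j w})"
  proof (rule integral_mono[OF integrable_bern[OF V] integrable_bern[OF V]])
    fix w
    have "1 \<le> (1 / t) ^ K * t ^ card {j \<in> J. P j w}" if "card {j \<in> J. P j w} < K"
    proof -
      have "t ^ K \<le> t ^ card {j \<in> J. P j w}"
        using that t by (intro power_decreasing) auto
      then show ?thesis using t by (simp add: field_simps)
    qed
    then show "indicator {w. card {j \<in> J. P j w} < K} w \<le> (1 / t) ^ K * t ^ card {j \<in> J. P j w}"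
      using t by (auto simp: indicator_def)
  qed
  also have "\<dots> = (1 / t) ^ K * measure_pmf.expectation (bern V p) (\<lambda>w. \<Prod>j\<in>J. if P j w then t else 1)"
    unfolding pw by simp
  also have "measure_pmf.expectation (bern V p) (\<lambda>w. \<Prod>j\<in>J. if P j w then t else 1) =
      (\<Prod>j\<in>J. measure_pmf.expectation (bern V p) (\<lambda>w. if P j w then t else 1))"
  proof (rule expectation_prod_blocks[OF V J A disj])
    fix j assume "j \<in> J"
    then show "determined_by (A j) (\<lambda>w. if P j w then t else 1)"
      using dep unfolding determined_by_def by metis
  qed
  also have "\<dots> \<le> (\<Prod>j\<in>J. 1 - r * (1 - t))"
  proof (rule prod_mono)
    fix j assume j: "j \<in> J"
    \<comment> \<open>Linear in the indicator, so the expectation depends only on the probability of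
      \<open>P j\<close>.\<close>
    have "(\<lambda>w. if P j w then t else 1) = (\<lambda>w. 1 - (1 - t) * indicator {w. P j w} w)"
      by (auto simp: indicator_def)
    then have "measure_pmf.expectation (bern V p) (\<lambda>w. if P j w then t else 1) =
        1 - (1 - t) * measure ?M {w. P j w}"
      by (simp add: integrable_bern[OF V] del: of_bool_eq)
    moreover have "(1 - t) * r \<le> (1 - t) * measure ?M {w. P j w}"
      using r[OF j] t by (intro mult_left_mono) auto
    moreover have "(1 - t) * measure ?M {w. P j w} \<le> 1 * 1"
      using t by (intro mult_mono) auto
    ultimately show "0 \<le> measure_pmf.expectation (bern V p) (\<lambda>w. if P j w then t else 1) \<and>
        measure_pmf.expectation (bern V p) (\<lambda>w. if P j w then t else 1) \<le> 1 - r * (1 - t)"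
      by (simp add: mult.commute)
  qed
  finally show ?thesis using t by (simp add: mult_left_mono)
qed

text \<open>Only the atom at \<open>k\<close> is kept. The factor (1 - p)^n tends to 1 when n p
  tends to 0, so this matches the union bound for the tail to first order.\<close>

lemma binomial_tail_ge:
  assumes "0 \<le> p" "p \<le> 1"
  shows "real (n choose k) * p ^ k * (1 - p) ^ n \<le> measure_pmf.prob (binomial_pmf n p) {k..}"
proof -
  have "(1 - p) ^ n \<le> (1 - p) ^ (n - k)"
    using assms by (intro power_decreasing) auto
  then have "real (n choose k) * p ^ k * (1 - p) ^ n \<le> real (n choose k) * p ^ k * (1 - p) ^ (n - k)"
    using assms by (intro mult_left_mono) auto
  also have "\<dots> = measure_pmf.prob (binomial_pmf n p) {k}"
    using assms by (simp add: measure_pmf_single)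
  also have "\<dots> \<le> measure_pmf.prob (binomial_pmf n p) {k..}"
    by (intro measure_pmf.finite_measure_mono) auto
  finally show ?thesis .
qed

lemma prob_card_block_ge_le:
  assumes V: "finite V" and A: "A \<subseteq> V" and p: "0 \<le> p" "p \<le> 1"
  shows "measure_pmf.prob (bern V p) {w. k \<le> card {v \<in> A. w v}} \<le> real (card A choose k) * p ^ k"
proof -
  have finA: "finite A" using V A finite_subset by blast
  let ?J = "{B. B \<subseteq> A \<and> card B = k}"
  have "{w. k \<le> card {v \<in> A. w v}} \<subseteq> {w. \<exists>B\<in>?J. \<forall>v\<in>B. w v}"
  proof
    fix w assume "w \<in> {w. k \<le> card {v \<in> A. w v}}"
    then obtain B where "B \<subseteq> {v \<in> A. w v}" "card B = k"
      by (metis mem_Collect_eq obtain_subset_with_card_n)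
    then show "w \<in> {w. \<exists>B\<in>?J. \<forall>v\<in>B. w v}" by blast
  qed
  then have "measure_pmf.prob (bern V p) {w. k \<le> card {v \<in> A. w v}} \<le>
      measure_pmf.prob (bern V p) {w. \<exists>B\<in>?J. \<forall>v\<in>B. w v}"
    by (intro measure_pmf.finite_measure_mono) auto
  also have "\<dots> \<le> real (card ?J) * p ^ k"
    using A finA by (intro prob_Ex_all_le[OF V _ _ p]) auto
  also have "card ?J = card A choose k"
    using n_subsets[OF finA] by simp
  finally show ?thesis .
qed


section \<open>Bounds for fixed \<open>m\<close>, \<open>n\<close> and \<open>p\<close>\<close>

abbreviation tail :: "nat \<Rightarrow> real \<Rightarrow> nat \<Rightarrow> real" where
  "tail n p k \<equiv> measure_pmf.prob (binomial_pmf n p) {k..}"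

lemma finite_pverts_cyc_cliques [simp]: "finite (pverts (cyc_cliques m n))"
  by (simp add: pverts_cyc_cliques)

lemma line_count_eq_card: "line_count n b w i x = card {v \<in> site b i x ` {..<n}. w v}"
proof -
  have "{v \<in> site b i x ` {..<n}. w v} = site b i x ` {y. y < n \<and> w (site b i x y)}" by blast
  then show ?thesis
    unfolding line_count_def by (simp add: card_image inj_on_def)
qed

lemma determined_by_line_count: "determined_by (site b i x ` {..<n}) (\<lambda>w. line_count n b w i x)"
proof -
  have "line_count n b w i x = line_count n b w' i x"
    if "\<forall>v\<in>site b i x ` {..<n}. w v = w' v" for w w'
  proof -
    have "{y. y < n \<and> w (site b i x y)} = {y. y < n \<and> w' (site b i x y)}" using that by blast
    then show ?thesis unfolding line_count_def by simp
  qed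
  then show ?thesis unfolding determined_by_def by blast
qed

text \<open>Events of a plane are expressed through its line counts; in this form their dependence
  on the plane alone can be checked by rewriting with equal counts.\<close>

lemma determined_by_plane:
  assumes "\<And>w w'. (\<And>b x. x < n \<Longrightarrow> line_count n b w i x = line_count n b w' i x) \<Longrightarrow> Q w = Q w'"
  shows "determined_by ({i} \<times> {..<n} \<times> {..<n}) Q"
  unfolding determined_by_def
proof (intro allI impI)
  fix w w' :: "nat \<times> nat \<times> nat \<Rightarrow> bool"
  assume eq: "\<forall>v\<in>{i} \<times> {..<n} \<times> {..<n}. w v = w' v"
  show "Q w = Q w'"
  proof (rule assms)
    fix b x assume "x < n"
    then have "\<forall>v\<in>site b i x ` {..<n}. w v = w' v"
      using eq by (auto simp: site_def)
    then show "line_count n b w i x = line_count n b w' i x"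
      using determined_by_line_count[of b i x n] unfolding determined_by_def by blast
  qed
qed

lemma prob_Ex_le:
  assumes I: "finite I" and c: "\<And>i. i \<in> I \<Longrightarrow> measure_pmf.prob M {w. Q i w} \<le> c"
  shows "measure_pmf.prob M {w. \<exists>i\<in>I. Q i w} \<le> real (card I) * c"
proof -
  have "{w. \<exists>i\<in>I. Q i w} = (\<Union>i\<in>I. {w. Q i w})" by blast
  then have "measure_pmf.prob M {w. \<exists>i\<in>I. Q i w} \<le> (\<Sum>i\<in>I. measure_pmf.prob M {w. Q i w})"
    using measure_pmf.finite_measure_subadditive_finite[OF I, of "\<lambda>i. {w. Q i w}"] by simp
  also have "\<dots> \<le> (\<Sum>i\<in>I. c)" by (intro sum_mono c)
  finally show ?thesis by simp
qed

lemma prob_Un3_le: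
  assumes "A \<subseteq> B \<union> C \<union> D"
  shows "measure_pmf.prob M A \<le> measure_pmf.prob M B + measure_pmf.prob M C + measure_pmf.prob M D"
proof -
  have "measure_pmf.prob M A \<le> measure_pmf.prob M (B \<union> C \<union> D)"
    using assms by (intro measure_pmf.finite_measure_mono) auto
  also have "\<dots> \<le> measure_pmf.prob M (B \<union> C) + measure_pmf.prob M D"
    by (intro measure_Un_le) auto
  also have "measure_pmf.prob M (B \<union> C) \<le> measure_pmf.prob M B + measure_pmf.prob M C"
    by (intro measure_Un_le) auto
  finally show ?thesis by simp
qed

lemma binomial_le_power: "n choose k \<le> n ^ k"
  by (cases "k \<le> n") (simp_all add: binomial_le_pow binomial_eq_0)

context
  fixes m n :: nat and p :: real
  assumes p: "0 \<le> p" "p \<le> 1"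
begin

abbreviation \<mu> where "\<mu> S \<equiv> measure_pmf.prob (bern (pverts (cyc_cliques m n)) p) S"

lemma line_subset: "i < m \<Longrightarrow> x < n \<Longrightarrow> site b i x ` {..<n} \<subseteq> pverts (cyc_cliques m n)"
  by auto

lemma prob_line:
  assumes "i < m" "x < n"
  shows "\<mu> {w. k \<le> line_count n b w i x} = tail n p k"
proof -
  have "\<mu> {w. card {v \<in> site b i x ` {..<n}. w v} \<in> {k..}} =
      measure_pmf.prob (binomial_pmf (card (site b i x ` {..<n})) p) {k..}"
    using assms by (intro prob_card_block line_subset p) auto
  also have "card (site b i x ` {..<n}) = n" by (simp add: card_image inj_on_def)
  finally show ?thesis by (simp add: line_count_eq_card)
qed

text \<open>A fact about the binomial law that is read off an actual line of the graph, which
  therefore has to exist.\<close>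

lemma tail_le:
  assumes "0 < m" "0 < n"
  shows "tail n p k \<le> real (n choose k) * p ^ k"
proof -
  have "tail n p k \<le> real (card (site True 0 0 ` {..<n}) choose k) * p ^ k"
    unfolding prob_line[OF assms, of k True, symmetric] line_count_eq_card
    using assms by (intro prob_card_block_ge_le line_subset p) auto
  also have "card (site True 0 0 ` {..<n}) = n" by (simp add: card_image inj_on_def)
  finally show ?thesis .
qed

lemma prob_some_line_le:
  assumes I: "I \<subseteq> {..<m}"
  shows "\<mu> {w. \<exists>i\<in>I. \<exists>x<n. \<exists>b. k \<le> line_count n b w i x} \<le>
    2 * real (card I) * real n * (real (n choose k) * p ^ k)"
proof (cases "0 < n \<and> I \<noteq> {}")
  case False
  then show ?thesis by (auto simp: measure_pmf.emeasure_eq_measure)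
next
  case True
  let ?J = "I \<times> {..<n} \<times> (UNIV :: bool set)"
  have finI: "finite I" using I finite_subset by blast
  have m: "0 < m" using True I by auto
  have "{w. \<exists>i\<in>I. \<exists>x<n. \<exists>b. k \<le> line_count n b w i x} =
      {w. \<exists>j\<in>?J. k \<le> line_count n (snd (snd j)) w (fst j) (fst (snd j))}"
    by force
  also have "\<mu> \<dots> \<le> real (card ?J) * (real (n choose k) * p ^ k)"
  proof (rule prob_Ex_le)
    fix j assume "j \<in> ?J"
    then show "\<mu> {w. k \<le> line_count n (snd (snd j)) w (fst j) (fst (snd j))} \<le> real (n choose k) * p ^ k"
      using prob_line[of "fst j" "fst (snd j)"] tail_le[OF m] True I by auto
  qed (use finI in auto)
  also have "card ?J = card I * (n * 2)" by (simp add: card_cartesian_product)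
  finally show ?thesis by (simp add: mult_ac)
qed

text \<open>Union bound over all crosses. The factor 16 is 2 orientations times 2^3 subsets of the
  at most three planes allowed for \<open>Z\<close>; the powers of \<open>n\<close> count the
  position and the sets \<open>S\<close> and \<open>T\<close>.\<close>

lemma prob_cross_le:
  assumes i: "i < m"
  shows "\<mu> {w. cross m n w i k1 k2 k3} \<le> 16 * real n ^ (2 + k1 + k2) * p ^ (k1 + k2 + k3)"
proof -
  let ?N = "{j. j < m \<and> (j = i \<or> cyc_adj m i j)}"
  let ?U = "(UNIV :: bool set) \<times> {..<n} \<times> {..<n} \<times> {S. S \<subseteq> {..<n} \<and> card S = k1} \<times>
    {T. T \<subseteq> {..<n} \<and> card T = k2} \<times> Pow ?N"
  \<comment> \<open>Keeping the crossing site out of \<open>S\<close> and \<open>T\<close> makes the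
    three parts disjoint, so each index has exactly k1 + k2 + k3 sites.\<close>
  define J where "J = {(b, x, y, S, T, Z). (b, x, y, S, T, Z) \<in> ?U \<and> y \<notin> S \<and> x \<notin> T \<and> card Z = k3}"
  define A where "A = (\<lambda>(b, x, y, S, T, Z). site b i x ` S \<union> (\<lambda>x'. site b i x' y) ` T \<union>
    (\<lambda>j. site b j x y) ` Z)"
  have finU: "finite ?U" by simp
  have JU: "J \<subseteq> ?U" unfolding J_def by blast
  have finJ: "finite J" using finU JU by (rule rev_finite_subset)
  have "card ?N \<le> card (insert i {(i + 1) mod m, if i = 0 then m - 1 else i - 1})"
    by (rule card_mono) (use cyc_adj_cases[of m i] i in blast)+
  also have "\<dots> \<le> 3" by (simp add: card_insert_if)
  finally have "(2::nat) ^ card ?N \<le> 2 ^ 3"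
    by (rule power_increasing) simp
  then have "card (Pow ?N) \<le> 2 ^ 3"
    by (subst card_Pow) auto
  then have "card ?U \<le> 2 * (n * (n * (n ^ k1 * (n ^ k2 * 2 ^ 3))))"
    using binomial_le_power[of n k1] binomial_le_power[of n k2]
    by (simp only: card_cartesian_product n_subsets finite_lessThan card_lessThan card_UNIV_bool)
       (intro mult_le_mono; simp)
  with card_mono[OF finU JU] have "card J \<le> 2 * (n * (n * (n ^ k1 * (n ^ k2 * 2 ^ 3))))"
    by (rule le_trans)
  then have cardJ: "card J \<le> 16 * n ^ (2 + k1 + k2)"
    by (simp add: power_add power2_eq_square mult_ac)
  have A: "A j \<subseteq> pverts (cyc_cliques m n) \<and> card (A j) = k1 + k2 + k3" if j: "j \<in> J" for j
  proof -
    obtain b x y S T Z where j': "j = (b, x, y, S, T, Z)" by (cases j)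
    have *: "x < n" "y < n" "S \<subseteq> {..<n}" "card S = k1" "T \<subseteq> {..<n}" "card T = k2" "Z \<subseteq> ?N"
      "card Z = k3" "y \<notin> S" "x \<notin> T" using j unfolding j' J_def by auto
    have fin: "finite S" "finite T" "finite Z"
      using * by (auto intro: finite_subset)
    have Aj: "A j = (site b i x ` S \<union> (\<lambda>x'. site b i x' y) ` T) \<union> (\<lambda>j. site b j x y) ` Z"
      unfolding A_def j' by simp
    have "card (A j) = card (site b i x ` S \<union> (\<lambda>x'. site b i x' y) ` T) + card ((\<lambda>j. site b j x y) ` Z)"
      unfolding Aj using fin * by (intro card_Un_disjoint) auto
    also have "card (site b i x ` S \<union> (\<lambda>x'. site b i x' y) ` T) =
        card (site b i x ` S) + card ((\<lambda>x'. site b i x' y) ` T)"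
      using fin * by (intro card_Un_disjoint) auto
    finally have "card (A j) = k1 + k2 + k3"
      using * by (simp add: card_image inj_on_def)
    moreover have "A j \<subseteq> pverts (cyc_cliques m n)"
      unfolding Aj using * i by auto
    ultimately show ?thesis by simp
  qed
  have "{w. cross m n w i k1 k2 k3} \<subseteq> {w. \<exists>j\<in>J. \<forall>v\<in>A j. w v}"
  proof
    fix w assume "w \<in> {w. cross m n w i k1 k2 k3}"
    then obtain b x y S T Z where *: "x < n" "y < n" "S \<subseteq> {..<n} - {y}" "card S = k1"
     "T \<subseteq> {..<n} - {x}" "card T = k2" "Z \<subseteq> ?N" "card Z = k3"
     "\<forall>y'\<in>S. w (site b i x y')" "\<forall>x'\<in>T. w (site b i x' y)" "\<forall>j\<in>Z. w (site b j x y)"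
      unfolding cross_def by blast
    have "(b, x, y, S, T, Z) \<in> J" unfolding J_def using * by auto
    moreover have "\<forall>v\<in>A (b, x, y, S, T, Z). w v" unfolding A_def using * by auto
    ultimately show "w \<in> {w. \<exists>j\<in>J. \<forall>v\<in>A j. w v}" by blast
  qed
  then have "\<mu> {w. cross m n w i k1 k2 k3} \<le> \<mu> {w. \<exists>j\<in>J. \<forall>v\<in>A j. w v}"
    by (intro measure_pmf.finite_measure_mono) auto
  also have "\<dots> \<le> real (card J) * p ^ (k1 + k2 + k3)"
    by (rule prob_Ex_all_le[OF _ finJ A p]) auto
  also have "\<dots> \<le> real (16 * n ^ (2 + k1 + k2)) * p ^ (k1 + k2 + k3)"
    using cardJ p by (intro mult_right_mono of_nat_mono) auto
  finally show ?thesis by simp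
qed

lemma prob_some_cross_le:
  assumes I: "I \<subseteq> {..<m}"
  shows "\<mu> {w. \<exists>i\<in>I. cross m n w i k1 k2 k3} \<le>
    real (card I) * (16 * real n ^ (2 + k1 + k2) * p ^ (k1 + k2 + k3))"
proof (rule prob_Ex_le)
  show "finite I" using I finite_subset by blast
  fix i assume "i \<in> I"
  then show "\<mu> {w. cross m n w i k1 k2 k3} \<le> 16 * real n ^ (2 + k1 + k2) * p ^ (k1 + k2 + k3)"
    using I by (intro prob_cross_le) auto
qed

section \<open>Independent lines and independent planes\<close>

lemma prob_not_less:
  "\<mu> {w. f w < (k::nat)} = 1 - \<mu> {w. k \<le> f w}"
proof -
  have "{w. f w < k} = UNIV - {w. k \<le> f w}" by auto
  then show ?thesis using measure_pmf.prob_compl[of "{w. k \<le> f w}"] by simp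
qed

text \<open>Parallel lines of a plane are disjoint, so the formula is exact; it treats one
  orientation at a time because rows and columns meet.\<close>

lemma prob_no_row:
  assumes i: "i < m"
  shows "\<mu> {w. \<forall>x<n. line_count n b w i x < k} = (1 - tail n p k) ^ n"
proof -
  have "\<mu> {w. \<forall>x\<in>{..<n}. line_count n b w i x < k} = (\<Prod>x<n. \<mu> {w. line_count n b w i x < k})"
  proof (rule prob_blocks)
    show "disjoint_family_on (\<lambda>x. site b i x ` {..<n}) {..<n}"
      unfolding disjoint_family_on_def by auto
    show "determined_by (site b i x ` {..<n}) (\<lambda>w. line_count n b w i x < k)" for x
      using determined_by_line_count[of b i x n] unfolding determined_by_def by metis
  qed (use i in auto)
  also have "\<dots> = (\<Prod>x<n. 1 - tail n p k)"
    by (intro prod.cong refl) (use prob_line[OF i] prob_not_less in simp)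
  finally show ?thesis by (simp add: Ball_def)
qed

lemma prob_planes:
  assumes I: "I \<subseteq> {..<m}"
    and Q: "\<And>i w w'. (\<And>b x. x < n \<Longrightarrow> line_count n b w i x = line_count n b w' i x) \<Longrightarrow> Q i w = Q i w'"
  shows "\<mu> {w. \<forall>i\<in>I. Q i w} = (\<Prod>i\<in>I. \<mu> {w. Q i w})"
proof (rule prob_blocks)
  show "finite I" using I finite_subset by blast
  show "disjoint_family_on (\<lambda>i. {i} \<times> {..<n} \<times> {..<n}) I"
    unfolding disjoint_family_on_def by auto
  show "determined_by ({i} \<times> {..<n} \<times> {..<n}) (Q i)" for i
    by (rule determined_by_plane) (rule Q)
  show "{i} \<times> {..<n} \<times> {..<n} \<subseteq> pverts (cyc_cliques m n)" if "i \<in> I" for i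
    using that I by (auto simp: pverts_cyc_cliques)
qed simp

lemma prob_no_blocking_plane:
  assumes I: "I \<subseteq> {..<m}"
  shows "\<mu> {w. \<forall>i\<in>I. \<exists>x<n. k \<le> line_count n True w i x} = (1 - (1 - tail n p k) ^ n) ^ card I"
proof -
  have "\<mu> {w. \<forall>i\<in>I. \<exists>x<n. k \<le> line_count n True w i x} =
      (\<Prod>i\<in>I. \<mu> {w. \<exists>x<n. k \<le> line_count n True w i x})"
    by (rule prob_planes[OF I]) metis
  also have "\<dots> = (\<Prod>i\<in>I. 1 - (1 - tail n p k) ^ n)"
  proof (intro prod.cong refl)
    fix i assume i: "i \<in> I"
    have "{w. \<exists>x<n. k \<le> line_count n True w i x} = UNIV - {w. \<forall>x<n. line_count n True w i x < k}"
      by (auto simp: not_less)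
    then show "\<mu> {w. \<exists>x<n. k \<le> line_count n True w i x} = 1 - (1 - tail n p k) ^ n"
      using measure_pmf.prob_compl[of "{w. \<forall>x<n. line_count n True w i x < k}"] prob_no_row[of i] i I
      by auto
  qed
  finally show ?thesis by simp
qed

text \<open>The exponential bound over \<open>n\<close> disjoint parallel lines, then a union over
  the 2m pairs of plane and orientation. The parameter \<open>t\<close> stays free; a small
  \<open>t\<close> costs only a factor 1 - t in the exponent.\<close>

lemma prob_bad_plane_le:
  assumes t: "0 < t" "t \<le> 1"
  shows "\<mu> {w. \<exists>i<m. \<not> good_plane n k K w i} \<le>
    2 * real m * ((1 / t) ^ K * (1 - tail n p k * (1 - t)) ^ n)"
proof -
  let ?J = "{..<m} \<times> (UNIV :: bool set)"
  have "{w. \<exists>i<m. \<not> good_plane n k K w i} =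
      {w. \<exists>j\<in>?J. card {x \<in> {..<n}. k \<le> line_count n (snd j) w (fst j) x} < K}"
    unfolding good_plane_def by (auto simp: not_le)
  also have "\<mu> \<dots> \<le> real (card ?J) * ((1 / t) ^ K * (1 - tail n p k * (1 - t)) ^ n)"
  proof (rule prob_Ex_le)
    fix j assume j: "j \<in> ?J"
    have "\<mu> {w. card {x \<in> {..<n}. k \<le> line_count n (snd j) w (fst j) x} < K} \<le>
        (1 / t) ^ K * (1 - tail n p k * (1 - t)) ^ card {..<n}"
    proof (rule prob_few_blocks_le)
      show "disjoint_family_on (\<lambda>x. site (snd j) (fst j) x ` {..<n}) {..<n}"
        unfolding disjoint_family_on_def by auto
      show "determined_by (site (snd j) (fst j) x ` {..<n}) (\<lambda>w. k \<le> line_count n (snd j) w (fst j) x)" for x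
        using determined_by_line_count[of "snd j" "fst j" x n] unfolding determined_by_def by metis
      show "tail n p k \<le> \<mu> {w. k \<le> line_count n (snd j) w (fst j) x}" if "x \<in> {..<n}" for x
        using prob_line[of "fst j" x k "snd j"] j that by auto
    qed (use j t in auto)
    then show "\<mu> {w. card {x \<in> {..<n}. k \<le> line_count n (snd j) w (fst j) x} < K} \<le>
        (1 / t) ^ K * (1 - tail n p k * (1 - t)) ^ n" by simp
  qed auto
  also have "card ?J = m * 2" by (simp add: card_cartesian_product)
  finally show ?thesis by (simp add: mult_ac)
qed

lemma prob_no_nucleus:
  "\<mu> {w. \<forall>i<m. \<forall>x<n. \<forall>b. line_count n b w i x < k} =
    (\<Prod>i<m. \<mu> {w. \<forall>x<n. \<forall>b. line_count n b w i x < k})"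
proof -
  have "\<mu> {w. \<forall>i\<in>{..<m}. \<forall>x<n. \<forall>b. line_count n b w i x < k} =
    (\<Prod>i<m. \<mu> {w. \<forall>x<n. \<forall>b. line_count n b w i x < k})"
  proof (rule prob_planes)
    fix i w w' assume eq: "\<And>b x. x < n \<Longrightarrow> line_count n b w i x = line_count n b w' i x"
    show "(\<forall>x<n. \<forall>b. line_count n b w i x < k) = (\<forall>x<n. \<forall>b. line_count n b w' i x < k)"
      by (auto simp: eq)
  qed simp
  then show ?thesis by (simp add: Ball_def)
qed

text \<open>A union bound over the 2n lines suffices within a plane, and independence is used
  between planes. The assumption keeps the base of the power nonnegative.\<close>

lemma prob_no_nucleus_ge:
  assumes "2 * real n * (real (n choose k) * p ^ k) \<le> 1"
  shows "(1 - 2 * real n * (real (n choose k) * p ^ k)) ^ m \<le>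
    \<mu> {w. \<forall>i<m. \<forall>x<n. \<forall>b. line_count n b w i x < k}"
proof -
  have "(\<Prod>i<m. 1 - 2 * real n * (real (n choose k) * p ^ k)) \<le>
      (\<Prod>i<m. \<mu> {w. \<forall>x<n. \<forall>b. line_count n b w i x < k})"
  proof (rule prod_mono, intro conjI)
    fix i assume i: "i \<in> {..<m}"
    have "{w. \<forall>x<n. \<forall>b. line_count n b w i x < k} =
        UNIV - {w. \<exists>i\<in>{i}. \<exists>x<n. \<exists>b. k \<le> line_count n b w i x}"
      unfolding not_less[symmetric] by blast
    then have "\<mu> {w. \<forall>x<n. \<forall>b. line_count n b w i x < k} =
        1 - \<mu> {w. \<exists>i\<in>{i}. \<exists>x<n. \<exists>b. k \<le> line_count n b w i x}"
      using measure_pmf.prob_compl[of "{w. \<exists>i\<in>{i}. \<exists>x<n. \<exists>b. k \<le> line_count n b w i x}"] by simp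
    then show "1 - 2 * real n * (real (n choose k) * p ^ k) \<le>
        \<mu> {w. \<forall>x<n. \<forall>b. line_count n b w i x < k}"
      using prob_some_line_le[of "{i}" k] i by simp
  qed (use assms in simp)
  then show ?thesis unfolding prob_no_nucleus by simp
qed

text \<open>The last two terms bound the probability that a plane contains both a row and a column with
  \<open>l + 1\<close> infected sites, according to whether or not their common site is infected.\<close>

lemma prob_no_nucleus_le:
  "\<mu> {w. \<forall>i<m. \<forall>x<n. \<forall>b. line_count n b w i x < l + 1} \<le>
    (1 - (2 * (1 - (1 - tail n p (l + 1)) ^ n) -
      (16 * real n ^ (2 + l + l) * p ^ (l + l + 1) +
       16 * real n ^ (2 + (l + 1) + (l + 1)) * p ^ ((l + 1) + (l + 1))))) ^ m"
    (is "_ \<le> (1 - (2 * (1 - ?r) - ?c)) ^ m")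
proof -
  have "(\<Prod>i<m. \<mu> {w. \<forall>x<n. \<forall>b. line_count n b w i x < l + 1}) \<le> (\<Prod>i<m. 1 - (2 * (1 - ?r) - ?c))"
  proof (rule prod_mono, intro conjI)
    fix i assume "i \<in> {..<m}"
    then have i: "i < m" by simp
    let ?R = "\<lambda>b. {w. \<forall>x<n. line_count n b w i x < l + 1}"
    have split: "{w. \<forall>x<n. \<forall>b. line_count n b w i x < l + 1} = ?R True \<inter> ?R False"
      by (auto simp: all_bool_eq)
    have "UNIV - (?R True \<union> ?R False) \<subseteq> {w. cross m n w i l l 1} \<union> {w. cross m n w i (l + 1) (l + 1) 0} \<union> {}"
    proof
      fix w assume "w \<in> UNIV - (?R True \<union> ?R False)"
      then obtain x y where "x < n" "y < n" "l + 1 \<le> line_count n True w i x" "l + 1 \<le> line_count n False w i y"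
        by (auto simp: not_less)
      then show "w \<in> {w. cross m n w i l l 1} \<union> {w. cross m n w i (l + 1) (l + 1) 0} \<union> {}"
        using cross_of_two_lines[OF i] by blast
    qed
    then have "\<mu> (UNIV - (?R True \<union> ?R False)) \<le> \<mu> {w. cross m n w i l l 1} + \<mu> {w. cross m n w i (l + 1) (l + 1) 0} + \<mu> {}"
      by (rule prob_Un3_le)
    also have "\<dots> \<le> ?c"
      using prob_cross_le[OF i, of l l 1] prob_cross_le[OF i, of "l + 1" "l + 1" 0] by simp
    finally have "1 - \<mu> (?R True \<union> ?R False) \<le> ?c"
      using measure_pmf.prob_compl[of "?R True \<union> ?R False"] by simp
    \<comment> \<open>Inclusion-exclusion: the intersection has probability 2r minus that of the
      union, hence at most 2r - 1 + c = 1 - (2(1 - r) - c).\<close>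
    moreover have "\<mu> (?R True \<union> ?R False) = \<mu> (?R True) + \<mu> (?R False) - \<mu> (?R True \<inter> ?R False)"
      by (intro measure_Un3) (auto simp: measure_pmf.fmeasurable_eq_sets)
    moreover have "\<mu> (?R b) = ?r" for b using prob_no_row[OF i] .
    ultimately show "\<mu> {w. \<forall>x<n. \<forall>b. line_count n b w i x < l + 1} \<le> 1 - (2 * (1 - ?r) - ?c)"
      unfolding split by simp
  qed simp
  then show ?thesis unfolding prob_no_nucleus by simp
qed

section \<open>Bounds on the spanning probability\<close>

lemma prob_Span_ge:
  assumes m: "3 \<le> m" and t: "0 < t" "t \<le> 1"
  shows "1 - (1 - (2 * (1 - (1 - tail n p (l + 1)) ^ n) -
      (16 * real n ^ (2 + l + l) * p ^ (l + l + 1) +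
       16 * real n ^ (2 + (l + 1) + (l + 1)) * p ^ ((l + 1) + (l + 1))))) ^ m
    - 2 * real m * ((1 / t) ^ (3 * l + 2) * (1 - tail n p l * (1 - t)) ^ n)
    - 2 * real m * real n * (real (n choose (l + 2)) * p ^ (l + 2))
    \<le> \<mu> (Span (cyc_cliques m n) (2 * l + 1))"
proof -
  let ?S = "Span (cyc_cliques m n) (2 * l + 1)"
  have "UNIV - ?S \<subseteq> {w. \<forall>i<m. \<forall>x<n. \<forall>b. line_count n b w i x < l + 1} \<union>
      {w. \<exists>i<m. \<not> good_plane n l (3 * l + 2) w i} \<union>
      {w. \<exists>i\<in>{..<m}. \<exists>x<n. \<exists>b. l + 2 \<le> line_count n b w i x}"
  proof (rule subsetI, rule ccontr)
    fix w assume w: "w \<in> UNIV - ?S" and nw: "w \<notin> {w. \<forall>i<m. \<forall>x<n. \<forall>b. line_count n b w i x < l + 1} \<union>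
      {w. \<exists>i<m. \<not> good_plane n l (3 * l + 2) w i} \<union>
      {w. \<exists>i\<in>{..<m}. \<exists>x<n. \<exists>b. l + 2 \<le> line_count n b w i x}"
    then have "\<not> (\<forall>i<m. \<forall>x<n. \<forall>b. line_count n b w i x < l + 1)" by blast
    then obtain i x b where *: "i < m" "x < n" "l + 1 \<le> line_count n b w i x"
      by (meson not_less)
    have good: "good_plane n l (3 * l + 2) w i" if "i < m" for i
      using nw that by blast
    have "\<not> l + 2 \<le> line_count n b w i x" if "i < m" "x < n" for i x b
      using nw that by blast
    then have "line_count n b w i x < l + 2" if "i < m" "x < n" for i x b
      using that not_le by blast
    then have "w \<in> ?S" by (intro nucleus_spans[OF m * _ good]) auto
    then show False using w by blast
  qed
  then have "\<mu> (UNIV - ?S) \<le> \<mu> {w. \<forall>i<m. \<forall>x<n. \<forall>b. line_count n b w i x < l + 1} +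
      \<mu> {w. \<exists>i<m. \<not> good_plane n l (3 * l + 2) w i} +
      \<mu> {w. \<exists>i\<in>{..<m}. \<exists>x<n. \<exists>b. l + 2 \<le> line_count n b w i x}"
    by (rule prob_Un3_le)
  moreover have "\<mu> (UNIV - ?S) = 1 - \<mu> ?S"
    using measure_pmf.prob_compl[of ?S] by simp
  ultimately show ?thesis
    using prob_no_nucleus_le[of l] prob_bad_plane_le[OF t, of l "3 * l + 2"]
      prob_some_line_le[of "{..<m}" "l + 2"] by simp
qed

lemma prob_Span_le:
  assumes mn: "0 < m" "l < n" and le: "2 * real n * (real (n choose (l + 1)) * p ^ (l + 1)) \<le> 1"
  shows "\<mu> (Span (cyc_cliques m n) (2 * l + 1)) \<le>
    1 - (1 - 2 * real n * (real (n choose (l + 1)) * p ^ (l + 1))) ^ m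
    + real m * (16 * real n ^ (2 + l + l) * p ^ (l + l + 1))
    + real m * (16 * real n ^ (2 + (l - 1) + l) * p ^ ((l - 1) + l + 2))"
proof -
  let ?S = "Span (cyc_cliques m n) (2 * l + 1)"
  let ?N = "{w. \<forall>i<m. \<forall>x<n. \<forall>b. line_count n b w i x < l + 1}"
  have "?S \<subseteq> (UNIV - ?N) \<union> {w. \<exists>i\<in>{..<m}. cross m n w i l l 1} \<union>
    {w. \<exists>i\<in>{..<m}. cross m n w i (l - 1) l 2}"
  proof (rule subsetI, rule ccontr)
    fix w assume w: "w \<in> ?S" and "w \<notin> (UNIV - ?N) \<union> {w. \<exists>i\<in>{..<m}. cross m n w i l l 1} \<union>
      {w. \<exists>i\<in>{..<m}. cross m n w i (l - 1) l 2}"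
    then have "w \<notin> ?S" by (intro not_Span_without_nucleus[OF mn]) (auto simp: less_Suc_eq_le)
    then show False using w by blast
  qed
  then have "\<mu> ?S \<le> \<mu> (UNIV - ?N) + \<mu> {w. \<exists>i\<in>{..<m}. cross m n w i l l 1} +
      \<mu> {w. \<exists>i\<in>{..<m}. cross m n w i (l - 1) l 2}"
    by (rule prob_Un3_le)
  moreover have "\<mu> (UNIV - ?N) = 1 - \<mu> ?N"
    using measure_pmf.prob_compl[of ?N] by simp
  ultimately show ?thesis
    using prob_no_nucleus_ge[OF le] prob_some_cross_le[of "{..<m}" l l 1]
      prob_some_cross_le[of "{..<m}" "l - 1" l 2] by simp
qed

text \<open>One blocking plane is found in each of two consecutive ranges of \<open>M\<close>
  planes, so B1 < B2 is automatic; starting at plane 1 and 2M + 1 < m keep the arc away from the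
  wrap-around. Nuclei and crosses are excluded in these 2M planes only.\<close>

lemma prob_Span_le_blocked:
  assumes M: "2 * M + 1 < m" and n: "l \<le> n" "1 \<le> l"
  shows "\<mu> (Span (cyc_cliques m n) (2 * l + 1)) \<le>
    2 * (1 - (1 - tail n p l) ^ n) ^ M
    + 2 * real (2 * M) * real n * (real (n choose (l + 1)) * p ^ (l + 1))
    + real (2 * M) * (16 * real n ^ (2 + (l - 1) + l) * p ^ ((l - 1) + l + 1))"
proof -
  let ?S = "Span (cyc_cliques m n) (2 * l + 1)"
  let ?I = "{1..2 * M}"
  let ?B = "\<lambda>I. {w. \<forall>i\<in>I. \<exists>x<n. l \<le> line_count n True w i x}"
  have "?S \<subseteq> (?B {1..M} \<union> ?B {M + 1..2 * M}) \<union> {w. \<exists>i\<in>?I. \<exists>x<n. \<exists>b. l + 1 \<le> line_count n b w i x} \<union>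
    {w. \<exists>i\<in>?I. cross m n w i (l - 1) l 1}"
  proof (rule subsetI, rule ccontr)
    fix w assume w: "w \<in> ?S" and nw: "w \<notin> (?B {1..M} \<union> ?B {M + 1..2 * M}) \<union>
      {w. \<exists>i\<in>?I. \<exists>x<n. \<exists>b. l + 1 \<le> line_count n b w i x} \<union> {w. \<exists>i\<in>?I. cross m n w i (l - 1) l 1}"
    then obtain B1 B2 where B: "B1 \<in> {1..M}" "B2 \<in> {M + 1..2 * M}"
      "\<And>x. x < n \<Longrightarrow> line_count n True w B1 x < l" "\<And>x. x < n \<Longrightarrow> line_count n True w B2 x < l"
      by (auto simp: not_le)
    have nl: "line_count n b w i x \<le> l" if "B1 \<le> i" "i \<le> B2" "x < n" for i x b
    proof -
      have "i \<in> ?I" using that B by simp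
      then have "\<not> l + 1 \<le> line_count n b w i x" using nw that(3) by blast
      then show ?thesis by simp
    qed
    have nc: "\<not> cross m n w i (l - 1) l 1" if "B1 \<le> i" "i \<le> B2" for i
    proof -
      have "i \<in> ?I" using that B by simp
      then show ?thesis using nw by blast
    qed
    have "w \<notin> ?S"
      by (rule not_Span_blocked[OF _ _ _ n nl B(3,4) nc]) (use B(1,2) M in auto)
    then show False using w by blast
  qed
  then have "\<mu> ?S \<le> \<mu> (?B {1..M} \<union> ?B {M + 1..2 * M}) +
      \<mu> {w. \<exists>i\<in>?I. \<exists>x<n. \<exists>b. l + 1 \<le> line_count n b w i x} + \<mu> {w. \<exists>i\<in>?I. cross m n w i (l - 1) l 1}"
    by (rule prob_Un3_le)
  moreover have "\<mu> (?B {1..M} \<union> ?B {M + 1..2 * M}) \<le> \<mu> (?B {1..M}) + \<mu> (?B {M + 1..2 * M})"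
    by (intro measure_Un_le) auto
  moreover have "\<mu> (?B {1..M}) = (1 - (1 - tail n p l) ^ n) ^ M"
    using M by (subst prob_no_blocking_plane) auto
  moreover have "\<mu> (?B {M + 1..2 * M}) = (1 - (1 - tail n p l) ^ n) ^ M"
    using M by (subst prob_no_blocking_plane) auto
  moreover have sub: "?I \<subseteq> {..<m}" and "card ?I = 2 * M" using M by auto
  ultimately show ?thesis
    using prob_some_line_le[OF sub, of "l + 1"] prob_some_cross_le[OF sub, of "l - 1" l 1] by simp
qed

end


section \<open>Asymptotics\<close>

text \<open>Once |y| < 1/2, m |ln(1 - y) + y| is at most 2 m y^2, which vanishes since m y converges
  and y tends to 0. The sign of \<open>y\<close> is left open, because error terms are subtracted in
  the main application.\<close>

lemma tendsto_one_minus_power: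
  fixes m :: "nat \<Rightarrow> nat" and y :: "nat \<Rightarrow> real"
  assumes m: "filterlim (\<lambda>n. real (m n)) at_top sequentially"
    and my: "(\<lambda>n. real (m n) * y n) \<longlonglongrightarrow> c"
  shows "y \<longlonglongrightarrow> 0" "(\<lambda>n. (1 - y n) ^ m n) \<longlonglongrightarrow> exp (- c)"
proof -
  have m_pos: "\<forall>\<^sub>F n in sequentially. real (m n) > 0"
    using m unfolding filterlim_at_top_dense by blast
  have "(\<lambda>n. real (m n) * y n / real (m n)) \<longlonglongrightarrow> 0"
    by (rule real_tendsto_divide_at_top[OF my m])
  then show y: "y \<longlonglongrightarrow> 0"
    by (rule Lim_transform_eventually) (use m_pos in eventually_elim, simp)
  have yb: "\<forall>\<^sub>F n in sequentially. \<bar>y n\<bar> < 1 / 2"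
    using tendstoD[OF y, of "1 / 2"] by simp
  have "(\<lambda>n. 2 * \<bar>real (m n) * y n\<bar> * \<bar>y n\<bar>) \<longlonglongrightarrow> 2 * \<bar>c\<bar> * \<bar>0\<bar>"
    by (intro tendsto_intros my y)
  then have z: "(\<lambda>n. 2 * \<bar>real (m n) * y n\<bar> * \<bar>y n\<bar>) \<longlonglongrightarrow> 0" by simp
  have "(\<lambda>n. real (m n) * (ln (1 - y n) + y n)) \<longlonglongrightarrow> 0"
  proof (rule Lim_null_comparison[OF _ z])
    show "\<forall>\<^sub>F n in sequentially. norm (real (m n) * (ln (1 - y n) + y n)) \<le> 2 * \<bar>real (m n) * y n\<bar> * \<bar>y n\<bar>"
      using yb
    proof eventually_elim
      case (elim n)
      have "\<bar>ln (1 + (- y n)) - (- y n)\<bar> \<le> 2 * (- y n)\<^sup>2"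
        using elim by (intro abs_ln_one_plus_x_minus_x_bound) simp
      then have "real (m n) * \<bar>ln (1 - y n) + y n\<bar> \<le> real (m n) * (2 * (y n)\<^sup>2)"
        by (intro mult_left_mono) simp_all
      then show ?case by (simp add: abs_mult power2_eq_square mult_ac)
    qed
  qed
  from tendsto_diff[OF this my]
  have "(\<lambda>n. real (m n) * ln (1 - y n)) \<longlonglongrightarrow> - c" by (simp add: algebra_simps)
  then have "(\<lambda>n. exp (real (m n) * ln (1 - y n))) \<longlonglongrightarrow> exp (- c)" by (rule tendsto_exp)
  then show "(\<lambda>n. (1 - y n) ^ m n) \<longlonglongrightarrow> exp (- c)"
  proof (rule Lim_transform_eventually)
    show "\<forall>\<^sub>F n in sequentially. exp (real (m n) * ln (1 - y n)) = (1 - y n) ^ m n"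
      using yb by eventually_elim (simp add: exp_of_nat_mult)
  qed
qed

text \<open>Compare with 1 / (1 + x), using (1 + x)(1 - x + x^2) = 1 + x^3.\<close>

lemma exp_minus_le:
  fixes x :: real
  assumes "0 \<le> x"
  shows "exp (- x) \<le> 1 - x + x\<^sup>2"
proof -
  have "exp (- x) = 1 / exp x" by (simp add: exp_minus field_simps)
  also have "\<dots> \<le> 1 / (1 + x)"
    using assms exp_ge_add_one_self[of x] by (intro divide_left_mono) auto
  also have "\<dots> \<le> 1 - x + x\<^sup>2"
    using assms by (simp add: field_simps power2_eq_square)
  finally show ?thesis .
qed

lemma one_minus_power_le_exp:
  fixes x :: real
  assumes "x \<le> 1"
  shows "(1 - x) ^ n \<le> exp (- (real n * x))"
proof -
  have "(1 - x) ^ n \<le> exp (- x) ^ n"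
    using assms exp_ge_add_one_self[of "- x"] by (intro power_mono) auto
  then show ?thesis by (simp add: exp_of_nat_mult[symmetric])
qed

text \<open>Bonferroni-type bounds: the error (n r)^2 is negligible against n r once n r tends to
  0.\<close>

lemma one_minus_power_bounds:
  fixes r :: real
  assumes "0 \<le> r" "r \<le> 1"
  shows "1 - (1 - r) ^ n \<le> real n * r" "real n * r - (real n * r)\<^sup>2 \<le> 1 - (1 - r) ^ n"
proof -
  show "1 - (1 - r) ^ n \<le> real n * r"
    using Bernoulli_inequality[of "- r" n] assms by simp
  show "real n * r - (real n * r)\<^sup>2 \<le> 1 - (1 - r) ^ n"
    using one_minus_power_le_exp[OF assms(2), of n] exp_minus_le[of "real n * r"] assms by simp
qed

lemma choose_over_power_tendsto: "(\<lambda>n. real (n choose k) / real n ^ k) \<longlonglongrightarrow> 1 / fact k"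
proof (induction k)
  case 0
  then show ?case by simp
next
  case (Suc k)
  have "(\<lambda>n. real n / real n - real k / real n) \<longlonglongrightarrow> 1"
    by real_asymp
  from tendsto_mult[OF Suc.IH tendsto_divide[OF this tendsto_const[of "real (Suc k)"]]]
  have "(\<lambda>n. real (n choose k) / real n ^ k * ((real n / real n - real k / real n) / real (Suc k))) \<longlonglongrightarrow>
      1 / fact (Suc k)"
    by (simp add: mult_ac)
  moreover have "\<forall>\<^sub>F n in sequentially. real (n choose k) / real n ^ k * ((real n / real n - real k / real n) / real (Suc k)) =
      real (n choose Suc k) / real n ^ Suc k"
    using eventually_gt_at_top[of k]
  proof eventually_elim
    case (elim n)
    have "Suc k * (n choose Suc k) = (n - k) * (n choose k)"
      by (simp only: binomial_absorption binomial_absorb_comp)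
    then have "real (Suc k) * real (n choose Suc k) = (real n - real k) * real (n choose k)"
      using elim by (metis of_nat_diff of_nat_mult less_imp_le)
    then have "real (n choose Suc k) = (real n - real k) * real (n choose k) / real (Suc k)"
      by (simp add: field_simps del: of_nat_Suc)
    moreover have "real n / real n - real k / real n = (real n - real k) / real n"
      by (simp only: diff_divide_distrib)
    ultimately show ?case by (simp add: mult_ac del: of_nat_Suc)
  qed
  ultimately show ?case by (rule Lim_transform_eventually)
qed

lemma ln_powr_mult_powr_tendsto_0:
  assumes "d < 0"
  shows "(\<lambda>n. ln (real n) powr s * real n powr d) \<longlonglongrightarrow> 0"
  using assms by real_asymp

lemma powr_over_ln_powr_dominates:
  assumes "0 < c" "c < b"
  shows "filterlim (\<lambda>n. real n powr b / ln (real n) powr (1 + b) / 2 - (2 * real n powr c + 1)) at_top sequentially"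
  using assms by real_asymp

section \<open>Scaling of \<open>m\<close> and \<open>p\<close>\<close>

context
  fixes l :: nat and m :: "nat \<Rightarrow> nat" and p :: "nat \<Rightarrow> real" and a :: real
  assumes l: "l \<ge> 1"
    and m_asymp: "(\<lambda>n. real (m n)) \<sim>[at_top]
           (\<lambda>n. real n powr (1 / real l) / ln (real n) powr (1 + 1 / real l))"
    and a: "a > 0"
    and p01: "\<And>n. 0 \<le> p n \<and> p n \<le> 1"
    and p_asymp: "p \<sim>[at_top]
           (\<lambda>n. a * (ln (real n) powr (1 / real l) / real n powr (1 + 1 / real l)))"
begin

definition p_rate :: "nat \<Rightarrow> real" where
  "p_rate n = ln (real n) powr (1 / real l) / real n powr (1 + 1 / real l)"

definition m_rate :: "nat \<Rightarrow> real" where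
  "m_rate n = real n powr (1 / real l) / ln (real n) powr (1 + 1 / real l)"

lemma ev_ge_3: "\<forall>\<^sub>F n in sequentially. n \<ge> 3"
  by (rule eventually_ge_at_top)

lemma p_rate_pos: "n \<ge> 3 \<Longrightarrow> 0 < p_rate n" and m_rate_pos: "n \<ge> 3 \<Longrightarrow> 0 < m_rate n"
  unfolding p_rate_def m_rate_def by simp_all

lemma p_over_rate: "(\<lambda>n. p n / p_rate n) \<longlonglongrightarrow> a"
proof -
  have "(\<lambda>n. p n / (a * p_rate n)) \<longlonglongrightarrow> 1"
    using p_asymp unfolding p_rate_def[symmetric]
    by (rule asymp_equivD_strong) (use ev_ge_3 in eventually_elim, use a p_rate_pos in \<open>simp add: less_imp_neq[symmetric]\<close>)
  from tendsto_mult[OF tendsto_const[of a] this] show ?thesis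
    using a by simp
qed

lemma m_over_rate: "(\<lambda>n. real (m n) / m_rate n) \<longlonglongrightarrow> 1"
  using m_asymp unfolding m_rate_def[symmetric]
  by (rule asymp_equivD_strong) (use ev_ge_3 in eventually_elim, use m_rate_pos in \<open>simp add: less_imp_neq[symmetric]\<close>)

lemma p_le: "\<forall>\<^sub>F n in sequentially. p n \<le> 2 * a * p_rate n"
proof -
  have "\<forall>\<^sub>F n in sequentially. p n / p_rate n < 2 * a"
    using p_over_rate a by (intro order_tendstoD) auto
  then show ?thesis using ev_ge_3
  proof eventually_elim
    case (elim n)
    then show ?case using p_rate_pos[of n] by (simp add: field_simps)
  qed
qed

lemma ln_ge_1: "n \<ge> 3 \<Longrightarrow> 1 \<le> ln (real n)"
proof -
  assume "n \<ge> 3"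
  then have "exp 1 \<le> real n" using exp_le by linarith
  then show ?thesis using \<open>n \<ge> 3\<close> by (simp add: ln_ge_iff)
qed

text \<open>Drops the logarithm, for estimates that have a power of \<open>n\<close> to
  spare.\<close>

lemma m_le: "\<forall>\<^sub>F n in sequentially. real (m n) \<le> 2 * real n powr (1 / real l)"
proof -
  have "\<forall>\<^sub>F n in sequentially. real (m n) / m_rate n < 2"
    using m_over_rate by (intro order_tendstoD) auto
  then show ?thesis using ev_ge_3
  proof eventually_elim
    case (elim n)
    have "1 \<le> ln (real n) powr (1 + 1 / real l)"
      using ln_ge_1[OF elim(2)] by (intro ge_one_powr_ge_zero) auto
    then have "m_rate n \<le> real n powr (1 / real l)"
      unfolding m_rate_def by (simp add: divide_le_eq mult_right_le_one_le mult_le_cancel_left1)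
    then show ?case using elim m_rate_pos[of n] by (simp add: field_simps)
  qed
qed

lemma m_ge: "\<forall>\<^sub>F n in sequentially. m_rate n / 2 \<le> real (m n)"
proof -
  have "\<forall>\<^sub>F n in sequentially. real (m n) / m_rate n > 1 / 2"
    using m_over_rate by (intro order_tendstoD) auto
  then show ?thesis using ev_ge_3
  proof eventually_elim
    case (elim n)
    then show ?case using m_rate_pos[of n] by (simp add: field_simps)
  qed
qed

lemma m_rate_dominates_powr:
  assumes "0 < c" "c < 1 / real l"
  shows "filterlim (\<lambda>n. m_rate n / 2 - (2 * real n powr c + 1)) at_top sequentially"
  unfolding m_rate_def by (rule powr_over_ln_powr_dominates[OF assms])

lemma m_at_top: "filterlim (\<lambda>n. real (m n)) at_top sequentially"
proof (rule filterlim_at_top_mono)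
  show "filterlim (\<lambda>n. m_rate n / 2 - (2 * real n powr (1 / (2 * real l)) + 1)) at_top sequentially"
    using l by (intro m_rate_dominates_powr) (simp_all add: field_simps)
  show "\<forall>\<^sub>F n in sequentially. m_rate n / 2 - (2 * real n powr (1 / (2 * real l)) + 1) \<le> real (m n)"
    using m_ge
  proof eventually_elim
    case (elim n)
    have "0 \<le> real n powr (1 / (2 * real l))" by simp
    with elim show ?case by linarith
  qed
qed

text \<open>Power counting: the product is at most a power of log n times n^(s + j - k(1 + 1/l)),
  and a negative power of \<open>n\<close> beats every power of the logarithm.\<close>

lemma negligible:
  fixes u :: "nat \<Rightarrow> real"
  assumes u: "\<And>n. 0 \<le> u n" "\<forall>\<^sub>F n in sequentially. u n \<le> C * real n powr s"
    and neg: "s + real j < real k * (1 + 1 / real l)"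
  shows "(\<lambda>n. u n * (real n ^ j * p n ^ k)) \<longlonglongrightarrow> 0"
proof (rule real_tendsto_sandwich[OF _ _ tendsto_const])
  define d where "d = s + real j - real k * (1 + 1 / real l)"
  have "(\<lambda>n. ln (real n) powr (real k / real l) * real n powr d) \<longlonglongrightarrow> 0"
    using neg by (intro ln_powr_mult_powr_tendsto_0) (simp add: d_def)
  from tendsto_mult[OF tendsto_const[of "C * (2 * a) ^ k"] this]
  show "(\<lambda>n. C * (2 * a) ^ k * (ln (real n) powr (real k / real l) * real n powr d)) \<longlonglongrightarrow> 0"
    by simp
  show "\<forall>\<^sub>F n in sequentially. 0 \<le> u n * (real n ^ j * p n ^ k)"
    using u(1) p01 by (intro always_eventually) simp
  show "\<forall>\<^sub>F n in sequentially. u n * (real n ^ j * p n ^ k) \<le>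
      C * (2 * a) ^ k * (ln (real n) powr (real k / real l) * real n powr d)"
    using u(2) p_le ev_ge_3
  proof eventually_elim
    case (elim n)
    have lnp: "0 < ln (real n)" using ln_ge_1[of n] elim by simp
    have nj: "real n ^ j = real n powr real j"
      using elim by (simp add: powr_realpow)
    have "p n ^ k \<le> (2 * a * p_rate n) ^ k"
      using elim p01 by (intro power_mono) auto
    then have "u n * (real n ^ j * p n ^ k) \<le> (C * real n powr s) * (real n ^ j * (2 * a * p_rate n) ^ k)"
      using elim u(1)[of n] p01[of n] by (intro mult_mono) (auto intro: order_trans)
    also have "(2 * a * p_rate n) ^ k = (2 * a) ^ k * (ln (real n) powr (real k / real l) / real n powr (real k * (1 + 1 / real l)))"
      unfolding p_rate_def using elim lnp by (simp add: power_mult_distrib power_divide powr_power mult_ac)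
    finally have "u n * (real n ^ j * p n ^ k) \<le> C * real n powr s * (real n powr real j * ((2 * a) ^ k * (ln (real n) powr (real k / real l) / real n powr (real k * (1 + 1 / real l)))))"
      by (simp only: nj)
    also have "C * real n powr s * (real n powr real j * ((2 * a) ^ k * (ln (real n) powr (real k / real l) / real n powr (real k * (1 + 1 / real l))))) =
        C * (2 * a) ^ k * (ln (real n) powr (real k / real l) * (real n powr s * real n powr real j / real n powr (real k * (1 + 1 / real l))))"
      by simp
    also have "real n powr s * real n powr real j / real n powr (real k * (1 + 1 / real l)) = real n powr d"
      unfolding d_def by (simp add: powr_add powr_diff)
    finally show ?case .
  qed
qed

lemma negligible_m:
  assumes "1 / real l + real j < real k * (1 + 1 / real l)"
  shows "(\<lambda>n. real (m n) * (real n ^ j * p n ^ k)) \<longlonglongrightarrow> 0"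
  by (rule negligible[OF _ m_le assms]) simp

lemma np_tendsto_0: "(\<lambda>n. real n * p n) \<longlonglongrightarrow> 0"
  using negligible[of "\<lambda>_. 1" 1 0 1 1] l by simp

lemma one_minus_p_power: "(\<lambda>n. (1 - p n) ^ n) \<longlonglongrightarrow> 1"
proof (rule real_tendsto_sandwich[OF _ _ _ tendsto_const])
  show "(\<lambda>n. 1 - real n * p n) \<longlonglongrightarrow> 1"
    using tendsto_diff[OF tendsto_const[of 1] np_tendsto_0] by simp
  show "\<forall>\<^sub>F n in sequentially. 1 - real n * p n \<le> (1 - p n) ^ n"
    using one_minus_power_bounds(1) p01 by (intro always_eventually) (smt (verit))
  show "\<forall>\<^sub>F n in sequentially. (1 - p n) ^ n \<le> 1"
    using p01 by (intro always_eventually) (simp add: power_le_one)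
qed

text \<open>The identities that fix both scales: the first makes the number of rows with
  \<open>l\<close> sites of order log n, the second makes the mean number of nuclei converge, the
  logarithms of \<open>m\<close> and p^(l+1) cancelling exactly.\<close>

lemma rate_power:
  assumes "n \<ge> 3"
  shows "real n ^ Suc l * p_rate n ^ l = ln (real n)" "m_rate n * (real n ^ (l + 2) * p_rate n ^ (l + 1)) = 1"
proof -
  have lnp: "0 < ln (real n)" using ln_ge_1[of n] assms by simp
  have qk: "p_rate n ^ k = ln (real n) powr (real k / real l) / real n powr (real k * (1 + 1 / real l))" for k
    unfolding p_rate_def using assms lnp by (simp add: power_divide powr_power mult_ac)
  have nk: "real n ^ k = real n powr real k" for k
    using assms by (simp add: powr_realpow)
  have e1: "real l * (1 + 1 / real l) = real (Suc l)" using l by (simp add: field_simps)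
  show "real n ^ Suc l * p_rate n ^ l = ln (real n)"
    unfolding qk nk e1 using assms lnp l by simp
  have e2: "real (l + 1) / real l = 1 + 1 / real l" using l by (simp add: field_simps)
  have e3: "1 / real l + real (l + 2) = real (l + 1) * (1 + 1 / real l)" using l by (simp add: field_simps)
  have "real n powr (1 / real l) * real n powr real (l + 2) = real n powr (real (l + 1) * (1 + 1 / real l))"
    unfolding e3[symmetric] by (simp only: powr_add)
  then show "m_rate n * (real n ^ (l + 2) * p_rate n ^ (l + 1)) = 1"
    unfolding qk nk e2 m_rate_def using assms lnp by (simp add: field_simps)
qed

lemma choose_l_tendsto:
  "(\<lambda>n. real n * (real (n choose l) * p n ^ l) / ln (real n)) \<longlonglongrightarrow> a ^ l / fact l"
proof -
  have "(\<lambda>n. real (n choose l) / real n ^ l * (p n / p_rate n) ^ l) \<longlonglongrightarrow> 1 / fact l * a ^ l"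
    by (intro tendsto_intros choose_over_power_tendsto p_over_rate)
  moreover have "\<forall>\<^sub>F n in sequentially. real (n choose l) / real n ^ l * (p n / p_rate n) ^ l =
      real n * (real (n choose l) * p n ^ l) / ln (real n)"
    using ev_ge_3
  proof eventually_elim
    case (elim n)
    then show ?case using p_rate_pos[of n] unfolding rate_power(1)[OF elim, symmetric]
      by (simp add: field_simps)
  qed
  ultimately show ?thesis by (auto intro: Lim_transform_eventually)
qed

lemma choose_Suc_l_tendsto:
  "(\<lambda>n. real (m n) * (real n * (real (n choose (l + 1)) * p n ^ (l + 1)))) \<longlonglongrightarrow> a ^ (l + 1) / fact (l + 1)"
proof -
  have "(\<lambda>n. real (m n) / m_rate n * (real (n choose (l + 1)) / real n ^ (l + 1) * (p n / p_rate n) ^ (l + 1)))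
      \<longlonglongrightarrow> 1 * (1 / fact (l + 1) * a ^ (l + 1))"
    by (intro tendsto_intros choose_over_power_tendsto p_over_rate m_over_rate)
  moreover have "\<forall>\<^sub>F n in sequentially.
      real (m n) / m_rate n * (real (n choose (l + 1)) / real n ^ (l + 1) * (p n / p_rate n) ^ (l + 1)) =
      real (m n) * (real n * (real (n choose (l + 1)) * p n ^ (l + 1)))"
    using ev_ge_3
  proof eventually_elim
    case (elim n)
    have "real (m n) / m_rate n * (real (n choose (l + 1)) / real n ^ (l + 1) * (p n / p_rate n) ^ (l + 1)) =
        real (m n) * (real n * (real (n choose (l + 1)) * p n ^ (l + 1))) / (m_rate n * (real n ^ (l + 2) * p_rate n ^ (l + 1)))"
      using elim p_rate_pos[of n] m_rate_pos[of n] by (simp add: field_simps)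
    then show ?case unfolding rate_power(2)[OF elim] by simp
  qed
  ultimately show ?thesis by (auto intro: Lim_transform_eventually)
qed

section \<open>Limits of binomial tails and vanishing error terms\<close>

lemma tail_bounds:
  assumes "m n > 0" "n \<ge> 3"
  shows "real (n choose k) * p n ^ k * (1 - p n) ^ n \<le> tail n (p n) k"
    "tail n (p n) k \<le> real (n choose k) * p n ^ k"
  using binomial_tail_ge[of "p n" n k] tail_le[of "p n" "m n" n k] p01[of n] assms by auto

lemma ev_m_ge_3: "\<forall>\<^sub>F n in sequentially. m n \<ge> 3"
proof -
  have "\<forall>\<^sub>F n in sequentially. real (m n) \<ge> 3"
    using m_at_top unfolding filterlim_at_top by blast
  then show ?thesis by eventually_elim simp
qed

lemma tail_l_tendsto: "(\<lambda>n. real n * tail n (p n) l / ln (real n)) \<longlonglongrightarrow> a ^ l / fact l"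
proof (rule real_tendsto_sandwich[OF _ _ _ choose_l_tendsto])
  show "(\<lambda>n. real n * (real (n choose l) * p n ^ l) / ln (real n) * (1 - p n) ^ n) \<longlonglongrightarrow> a ^ l / fact l"
    using tendsto_mult[OF choose_l_tendsto one_minus_p_power] by simp
  show "\<forall>\<^sub>F n in sequentially. real n * (real (n choose l) * p n ^ l) / ln (real n) * (1 - p n) ^ n
      \<le> real n * tail n (p n) l / ln (real n)"
    using ev_ge_3 ev_m_ge_3
  proof eventually_elim
    case (elim n)
    then show ?case
      using mult_left_mono[OF tail_bounds(1)[of n l], of "real n"] ln_ge_1[of n]
      by (simp add: divide_right_mono mult_ac)
  qed
  show "\<forall>\<^sub>F n in sequentially. real n * tail n (p n) l / ln (real n) \<le>
      real n * (real (n choose l) * p n ^ l) / ln (real n)"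
    using ev_ge_3 ev_m_ge_3
  proof eventually_elim
    case (elim n)
    then show ?case
      using mult_left_mono[OF tail_bounds(2)[of n l], of "real n"] ln_ge_1[of n]
      by (simp add: divide_right_mono)
  qed
qed

lemma tail_Suc_l_tendsto:
  "(\<lambda>n. real (m n) * (real n * tail n (p n) (l + 1))) \<longlonglongrightarrow> a ^ (l + 1) / fact (l + 1)"
proof (rule real_tendsto_sandwich[OF _ _ _ choose_Suc_l_tendsto])
  show "(\<lambda>n. real (m n) * (real n * (real (n choose (l + 1)) * p n ^ (l + 1))) * (1 - p n) ^ n) \<longlonglongrightarrow> a ^ (l + 1) / fact (l + 1)"
    using tendsto_mult[OF choose_Suc_l_tendsto one_minus_p_power] by simp
  show "\<forall>\<^sub>F n in sequentially. real (m n) * (real n * (real (n choose (l + 1)) * p n ^ (l + 1))) * (1 - p n) ^ n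
      \<le> real (m n) * (real n * tail n (p n) (l + 1))"
    using ev_ge_3 ev_m_ge_3
  proof eventually_elim
    case (elim n)
    then show ?case
      using mult_left_mono[OF tail_bounds(1)[of n "l + 1"], of "real (m n) * real n"]
      by (simp add: mult_ac)
  qed
  show "\<forall>\<^sub>F n in sequentially. real (m n) * (real n * tail n (p n) (l + 1)) \<le>
      real (m n) * (real n * (real (n choose (l + 1)) * p n ^ (l + 1)))"
    using ev_ge_3 ev_m_ge_3
  proof eventually_elim
    case (elim n)
    then show ?case
      using mult_left_mono[OF tail_bounds(2)[of n "l + 1"], of "real (m n) * real n"]
      by (simp add: mult_ac)
  qed
qed

text \<open>The exponents of \<open>n\<close> after power counting are -1, -2 and -1/l, in this
  order.\<close>

lemma negligible_crosses:
  "(\<lambda>n. real (m n) * (16 * real n ^ (2 + l + l) * p n ^ (l + l + 1))) \<longlonglongrightarrow> 0"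
  "(\<lambda>n. real (m n) * (16 * real n ^ (2 + (l - 1) + l) * p n ^ ((l - 1) + l + 2))) \<longlonglongrightarrow> 0"
  "(\<lambda>n. real (m n) * (16 * real n ^ (2 + (l + 1) + (l + 1)) * p n ^ ((l + 1) + (l + 1)))) \<longlonglongrightarrow> 0"
proof -
  have scale: "(\<lambda>n. real (m n) * (16 * real n ^ j * p n ^ k)) \<longlonglongrightarrow> 0"
    if "1 / real l + real j < real k * (1 + 1 / real l)" for j k
    using tendsto_mult[OF tendsto_const[of 16] negligible_m[OF that]] by (simp add: mult_ac)
  show "(\<lambda>n. real (m n) * (16 * real n ^ (2 + l + l) * p n ^ (l + l + 1))) \<longlonglongrightarrow> 0"
    by (rule scale) (use l in \<open>simp add: field_simps\<close>)
  show "(\<lambda>n. real (m n) * (16 * real n ^ (2 + (l - 1) + l) * p n ^ ((l - 1) + l + 2))) \<longlonglongrightarrow> 0"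
    by (rule scale) (use l in \<open>simp add: field_simps of_nat_diff\<close>)
  show "(\<lambda>n. real (m n) * (16 * real n ^ (2 + (l + 1) + (l + 1)) * p n ^ ((l + 1) + (l + 1)))) \<longlonglongrightarrow> 0"
    by (rule scale) (use l in \<open>simp add: field_simps\<close>)
qed

lemma negligible_lines:
  "(\<lambda>n. 2 * real (m n) * real n * (real (n choose (l + 2)) * p n ^ (l + 2))) \<longlonglongrightarrow> 0"
proof (rule real_tendsto_sandwich[OF _ _ tendsto_const])
  have "(\<lambda>n. real (m n) * (real n ^ (l + 3) * p n ^ (l + 2))) \<longlonglongrightarrow> 0"
    by (rule negligible_m) (use l in \<open>simp add: field_simps\<close>)
  from tendsto_mult[OF tendsto_const[of 2] this]
  show "(\<lambda>n. 2 * real (m n) * real n * (real n ^ (l + 2) * p n ^ (l + 2))) \<longlonglongrightarrow> 0"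
    by (simp add: mult_ac eval_nat_numeral)
  show "\<forall>\<^sub>F n in sequentially. 0 \<le> 2 * real (m n) * real n * (real (n choose (l + 2)) * p n ^ (l + 2))"
    using p01 by (intro always_eventually) simp
  show "\<forall>\<^sub>F n in sequentially. 2 * real (m n) * real n * (real (n choose (l + 2)) * p n ^ (l + 2)) \<le>
      2 * real (m n) * real n * (real n ^ (l + 2) * p n ^ (l + 2))"
  proof (intro always_eventually allI mult_left_mono mult_right_mono)
    fix n
    show "real (n choose (l + 2)) \<le> real n ^ (l + 2)"
      using binomial_le_power[of n "l + 2"] by (metis of_nat_le_iff of_nat_power)
  qed (use p01 in auto)
qed

text \<open>A plane fails with probability of order at most n^(-c) for some c > 1/l, which beats the
  roughly n^(1/l) planes. As \<open>K\<close> is fixed, (1/t)^K is a constant.\<close>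

lemma bad_planes_negligible:
  assumes t: "0 < t" "t < 1" "a ^ l / fact l * (1 - t) > 1 / real l"
  shows "(\<lambda>n. 2 * real (m n) * ((1 / t) ^ K * (1 - tail n (p n) l * (1 - t)) ^ n)) \<longlonglongrightarrow> 0"
proof -
  obtain c where c: "1 / real l < c" "c < a ^ l / fact l * (1 - t)"
    using dense[OF t(3)] by blast
  have "(\<lambda>n. real n * tail n (p n) l / ln (real n) * (1 - t)) \<longlonglongrightarrow> a ^ l / fact l * (1 - t)"
    by (intro tendsto_intros tail_l_tendsto)
  then have ev: "\<forall>\<^sub>F n in sequentially. real n * tail n (p n) l / ln (real n) * (1 - t) > c"
    using c(2) by (intro order_tendstoD)
  have neg: "1 / real l - c < 0" using c by simp
  have "(\<lambda>n. real n powr (1 / real l - c)) \<longlonglongrightarrow> 0"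
    using neg by real_asymp
  from tendsto_mult[OF tendsto_const[of "4 * (1 / t) ^ K"] this]
  have lim: "(\<lambda>n. 4 * (1 / t) ^ K * real n powr (1 / real l - c)) \<longlonglongrightarrow> 0" by simp
  show ?thesis
  proof (rule real_tendsto_sandwich[OF _ _ tendsto_const lim])
    have le1: "tail n (p n) l * (1 - t) \<le> 1" for n
      using mult_mono[of "tail n (p n) l" 1 "1 - t" 1] t by simp
    show "\<forall>\<^sub>F n in sequentially. 0 \<le> 2 * real (m n) * ((1 / t) ^ K * (1 - tail n (p n) l * (1 - t)) ^ n)"
      using le1 t by (intro always_eventually) simp
    show "\<forall>\<^sub>F n in sequentially. 2 * real (m n) * ((1 / t) ^ K * (1 - tail n (p n) l * (1 - t)) ^ n)
      \<le> 4 * (1 / t) ^ K * real n powr (1 / real l - c)"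
      using ev m_le ev_ge_3
    proof eventually_elim
      case (elim n)
      have "(1 - tail n (p n) l * (1 - t)) ^ n \<le> exp (- (real n * (tail n (p n) l * (1 - t))))"
        by (rule one_minus_power_le_exp[OF le1])
      also have "\<dots> \<le> exp (- (c * ln (real n)))"
        using elim ln_ge_1[of n] by (simp add: field_simps)
      also have "\<dots> = real n powr (- c)"
        using elim by (simp add: powr_def)
      finally have "2 * real (m n) * ((1 / t) ^ K * (1 - tail n (p n) l * (1 - t)) ^ n) \<le>
          2 * (2 * real n powr (1 / real l)) * ((1 / t) ^ K * real n powr (- c))"
        using elim t le1[of n] by (intro mult_mono) auto
      also have "\<dots> = 4 * (1 / t) ^ K * (real n powr (1 / real l) * real n powr (- c))" by simp
      also have "real n powr (1 / real l) * real n powr (- c) = real n powr (1 / real l - c)"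
        by (simp add: powr_add[symmetric])
      finally show ?case .
    qed
  qed
qed

section \<open>Supercritical regime\<close>

abbreviation span_prob :: "nat \<Rightarrow> real" where
  "span_prob n \<equiv> measure_pmf.prob (bern (pverts (cyc_cliques (m n) n)) (p n))
     (Span (cyc_cliques (m n) n) (2 * l + 1))"

lemma span_prob_supercritical:
  assumes crit: "a ^ l / fact l > 1 / real l"
  shows "span_prob \<longlonglongrightarrow> 1 - exp (- 2 * a ^ (l + 1) / fact (l + 1))"
proof -
  define \<Lambda> where "\<Lambda> = a ^ (l + 1) / fact (l + 1)"
  define c where "c n = 16 * real n ^ (2 + l + l) * p n ^ (l + l + 1) +
       16 * real n ^ (2 + (l + 1) + (l + 1)) * p n ^ ((l + 1) + (l + 1))" for n
  define x where "x n = real n * tail n (p n) (l + 1)" for n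
  have mx: "(\<lambda>n. real (m n) * x n) \<longlonglongrightarrow> \<Lambda>"
    unfolding x_def \<Lambda>_def by (rule tail_Suc_l_tendsto)
  have x0: "x \<longlonglongrightarrow> 0" by (rule tendsto_one_minus_power(1)[OF m_at_top mx])
  have mc: "(\<lambda>n. real (m n) * c n) \<longlonglongrightarrow> 0"
    using tendsto_add[OF negligible_crosses(1,3)] unfolding c_def by (simp add: distrib_left)
  have mrow: "(\<lambda>n. real (m n) * (1 - (1 - tail n (p n) (l + 1)) ^ n)) \<longlonglongrightarrow> \<Lambda>"
  proof (rule real_tendsto_sandwich[OF _ _ _ mx])
    have "(\<lambda>n. real (m n) * x n - real (m n) * x n * x n) \<longlonglongrightarrow> \<Lambda> - \<Lambda> * 0"
      by (intro tendsto_intros mx x0)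
    then show "(\<lambda>n. real (m n) * (x n - (x n)\<^sup>2)) \<longlonglongrightarrow> \<Lambda>"
      by (simp add: algebra_simps power2_eq_square)
    show "\<forall>\<^sub>F n in sequentially. real (m n) * (x n - (x n)\<^sup>2) \<le> real (m n) * (1 - (1 - tail n (p n) (l + 1)) ^ n)"
      unfolding x_def by (intro always_eventually allI mult_left_mono one_minus_power_bounds) auto
    show "\<forall>\<^sub>F n in sequentially. real (m n) * (1 - (1 - tail n (p n) (l + 1)) ^ n) \<le> real (m n) * x n"
      unfolding x_def by (intro always_eventually allI mult_left_mono one_minus_power_bounds) auto
  qed
  define y where "y n = 2 * (1 - (1 - tail n (p n) (l + 1)) ^ n) - c n" for n
  have "(\<lambda>n. 2 * (real (m n) * (1 - (1 - tail n (p n) (l + 1)) ^ n)) - real (m n) * c n) \<longlonglongrightarrow> 2 * \<Lambda> - 0"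
    by (intro tendsto_intros mrow mc)
  then have my: "(\<lambda>n. real (m n) * y n) \<longlonglongrightarrow> 2 * \<Lambda>"
    unfolding y_def by (simp add: algebra_simps)
  \<comment> \<open>\<open>y\<close> and \<open>z\<close> bound the probability of a nucleus in one
    plane from below and above. Multiplied by \<open>m\<close> they have the same limit, so the
    sandwich closes.\<close>
  define z where "z n = 2 * real n * (real (n choose (l + 1)) * p n ^ (l + 1))" for n
  have mz: "(\<lambda>n. real (m n) * z n) \<longlonglongrightarrow> 2 * \<Lambda>"
    using tendsto_mult[OF tendsto_const[of 2] choose_Suc_l_tendsto] unfolding z_def \<Lambda>_def
    by (simp add: mult_ac)
  have z1: "\<forall>\<^sub>F n in sequentially. z n < 1"
    using tendsto_one_minus_power(1)[OF m_at_top mz] by (intro order_tendstoD) auto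
  define A where "A = a ^ l / fact l"
  obtain d where d: "1 / real l < d" "d < A" using dense[OF crit] unfolding A_def by blast
  have "0 < 1 / real l" using l by simp
  then have d0: "0 < d" using d by linarith
  \<comment> \<open>Chosen so that (a^l / l!)(1 - t) = d still exceeds 1 / l: the slack in the
    strict inequality pays for the exponential bound.\<close>
  define t where "t = 1 - d / A"
  have t: "0 < t" "t < 1" unfolding t_def using d d0 by simp_all
  have tt: "a ^ l / fact l * (1 - t) > 1 / real l"
    using d d0 unfolding A_def[symmetric] t_def by simp
  note bad = bad_planes_negligible[OF t tt, of "3 * l + 2"]
  have lim: "exp (- (2 * \<Lambda>)) = exp (- 2 * a ^ (l + 1) / fact (l + 1))"
    unfolding \<Lambda>_def by simp
  show ?thesis
  proof (rule real_tendsto_sandwich)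
    show "\<forall>\<^sub>F n in sequentially. 1 - (1 - y n) ^ m n
        - 2 * real (m n) * ((1 / t) ^ (3 * l + 2) * (1 - tail n (p n) l * (1 - t)) ^ n)
        - 2 * real (m n) * real n * (real (n choose (l + 2)) * p n ^ (l + 2)) \<le> span_prob n"
      using ev_m_ge_3
    proof eventually_elim
      case (elim n)
      show ?case
        using prob_Span_ge[of "p n" "m n" t n l] p01[of n] elim t unfolding y_def c_def by simp
    qed
    have "(\<lambda>n. 1 - (1 - y n) ^ m n
        - 2 * real (m n) * ((1 / t) ^ (3 * l + 2) * (1 - tail n (p n) l * (1 - t)) ^ n)
        - 2 * real (m n) * real n * (real (n choose (l + 2)) * p n ^ (l + 2))) \<longlonglongrightarrow> 1 - exp (- (2 * \<Lambda>)) - 0 - 0"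
      by (intro tendsto_diff tendsto_const tendsto_one_minus_power(2)[OF m_at_top my] bad negligible_lines)
    then show "(\<lambda>n. 1 - (1 - y n) ^ m n
        - 2 * real (m n) * ((1 / t) ^ (3 * l + 2) * (1 - tail n (p n) l * (1 - t)) ^ n)
        - 2 * real (m n) * real n * (real (n choose (l + 2)) * p n ^ (l + 2))) \<longlonglongrightarrow> 1 - exp (- 2 * a ^ (l + 1) / fact (l + 1))"
      unfolding lim by simp
    show "\<forall>\<^sub>F n in sequentially. span_prob n \<le> 1 - (1 - z n) ^ m n
        + real (m n) * (16 * real n ^ (2 + l + l) * p n ^ (l + l + 1))
        + real (m n) * (16 * real n ^ (2 + (l - 1) + l) * p n ^ ((l - 1) + l + 2))"
      using ev_m_ge_3 z1 eventually_gt_at_top[of l]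
    proof eventually_elim
      case (elim n)
      show ?case
        unfolding z_def using p01[of n] elim unfolding z_def by (intro prob_Span_le) auto
    qed
    have "(\<lambda>n. 1 - (1 - z n) ^ m n
        + real (m n) * (16 * real n ^ (2 + l + l) * p n ^ (l + l + 1))
        + real (m n) * (16 * real n ^ (2 + (l - 1) + l) * p n ^ ((l - 1) + l + 2))) \<longlonglongrightarrow> 1 - exp (- (2 * \<Lambda>)) + 0 + 0"
      by (intro tendsto_diff tendsto_add tendsto_const tendsto_one_minus_power(2)[OF m_at_top mz] negligible_crosses)
    then show "(\<lambda>n. 1 - (1 - z n) ^ m n
        + real (m n) * (16 * real n ^ (2 + l + l) * p n ^ (l + l + 1))
        + real (m n) * (16 * real n ^ (2 + (l - 1) + l) * p n ^ ((l - 1) + l + 2))) \<longlonglongrightarrow> 1 - exp (- 2 * a ^ (l + 1) / fact (l + 1))"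
      unfolding lim by simp
  qed
qed

section \<open>Subcritical regime\<close>

lemma one_minus_power_ge_powr:
  assumes "a ^ l / fact l < c"
  shows "\<forall>\<^sub>F n in sequentially. real n powr (- c) \<le> (1 - tail n (p n) l) ^ n"
proof -
  have "(\<lambda>n. ln (real n) / real n) \<longlonglongrightarrow> 0" by real_asymp
  from tendsto_mult[OF tail_l_tendsto this]
  have "(\<lambda>n. real n * tail n (p n) l / ln (real n) * (ln (real n) / real n)) \<longlonglongrightarrow> 0" by simp
  moreover have "\<forall>\<^sub>F n in sequentially. real n * tail n (p n) l / ln (real n) * (ln (real n) / real n) = tail n (p n) l"
    using ev_ge_3
  proof eventually_elim
    case (elim n)
    then show ?case using ln_ge_1[OF elim] by simp
  qed
  ultimately have r0: "(\<lambda>n. tail n (p n) l) \<longlonglongrightarrow> 0" by (rule Lim_transform_eventually)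
  have "(\<lambda>n. real n * tail n (p n) l / ln (real n) * (1 + 2 * tail n (p n) l)) \<longlonglongrightarrow> a ^ l / fact l * (1 + 2 * 0)"
    by (intro tendsto_intros tail_l_tendsto r0)
  then have "\<forall>\<^sub>F n in sequentially. real n * tail n (p n) l / ln (real n) * (1 + 2 * tail n (p n) l) < c"
    using assms by (intro order_tendstoD) auto
  moreover have "\<forall>\<^sub>F n in sequentially. tail n (p n) l < 1 / 2"
    using r0 by (intro order_tendstoD) auto
  ultimately show ?thesis using ev_ge_3
  proof eventually_elim
    case (elim n)
    define r where "r = tail n (p n) l"
    have r: "0 \<le> r" "r < 1 / 2" using elim unfolding r_def by auto
    have lnp: "0 < ln (real n)" using ln_ge_1[of n] elim by simp
    have "\<bar>ln (1 + (- r)) - (- r)\<bar> \<le> 2 * (- r)\<^sup>2"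
      using r by (intro abs_ln_one_plus_x_minus_x_bound) simp
    \<comment> \<open>The correction factor 1 + 2r tends to 1 and is absorbed by the gap between a^l
      / l! and \<open>c\<close>.\<close>
    then have lnr: "- (r * (1 + 2 * r)) \<le> ln (1 - r)"
      by (simp add: power2_eq_square algebra_simps abs_le_iff)
    have "real n * (r * (1 + 2 * r)) < c * ln (real n)"
      using elim(1) lnp unfolding r_def[symmetric] by (simp add: field_simps)
    moreover have "real n * - (r * (1 + 2 * r)) \<le> real n * ln (1 - r)"
      using lnr by (intro mult_left_mono) auto
    ultimately have "- c * ln (real n) \<le> real n * ln (1 - r)" by simp
    then have "exp (- c * ln (real n)) \<le> exp (real n * ln (1 - r))" by (subst exp_le_cancel_iff)
    also have "\<dots> = (1 - r) ^ n" using r by (simp add: exp_of_nat_mult)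
    finally show ?case using elim(3) unfolding r_def by (simp add: powr_def)
  qed
qed

lemma span_prob_subcritical:
  assumes crit: "a ^ l / fact l < 1 / real l"
  shows "span_prob \<longlonglongrightarrow> 0"
proof -
  obtain c where c: "a ^ l / fact l < c" "c < 1 / real l" using dense[OF crit] by blast
  \<comment> \<open>Eventually a plane is blocking with probability at least n^(-c'), so among about
    n^c planes the mean number of blocking ones grows at least like n^(c - c').\<close>
  obtain c' where c': "a ^ l / fact l < c'" "c' < c" using dense[OF c(1)] by blast
  have "0 < a ^ l / fact l" using a by simp
  then have pos: "0 < c'" "0 < c" using c' by linarith+
  define M where "M n = nat \<lfloor>real n powr c\<rfloor>" for n
  have M: "real (M n) \<le> real n powr c" "real n powr c - 1 \<le> real (M n)" for n
  proof -
    have "real (M n) = of_int \<lfloor>real n powr c\<rfloor>"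
      unfolding M_def by simp
    then show "real (M n) \<le> real n powr c" "real n powr c - 1 \<le> real (M n)"
      by linarith+
  qed
  have arc: "\<forall>\<^sub>F n in sequentially. 2 * M n + 1 < m n"
  proof -
    have "\<forall>\<^sub>F n in sequentially. 0 < m_rate n / 2 - (2 * real n powr c + 1)"
      using m_rate_dominates_powr[OF pos(2) c(2)] unfolding filterlim_at_top_dense by blast
    then show ?thesis using m_ge
    proof eventually_elim
      case (elim n)
      then show ?case using M(1)[of n] by linarith
    qed
  qed
  have block: "(\<lambda>n. (1 - (1 - tail n (p n) l) ^ n) ^ M n) \<longlonglongrightarrow> 0"
  proof (rule real_tendsto_sandwich[OF _ _ tendsto_const])
    have d: "0 < c - c'" using c' by simp
    show "(\<lambda>n. exp (- (real n powr (c - c') - real n powr (- c')))) \<longlonglongrightarrow> 0"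
      using d pos(1) by real_asymp
    show "\<forall>\<^sub>F n in sequentially. 0 \<le> (1 - (1 - tail n (p n) l) ^ n) ^ M n"
      by (intro always_eventually allI zero_le_power) (simp add: power_le_one)
    show "\<forall>\<^sub>F n in sequentially. (1 - (1 - tail n (p n) l) ^ n) ^ M n \<le>
        exp (- (real n powr (c - c') - real n powr (- c')))"
      using one_minus_power_ge_powr[OF c'(1)] ev_ge_3
    proof eventually_elim
      case (elim n)
      have "(1 - (1 - tail n (p n) l) ^ n) ^ M n \<le> (1 - real n powr (- c')) ^ M n"
        using elim by (intro power_mono) (auto simp: power_le_one)
      also have "\<dots> \<le> exp (- (real (M n) * real n powr (- c')))"
      proof (rule one_minus_power_le_exp)
        have "(1 - tail n (p n) l) ^ n \<le> 1" by (simp add: power_le_one)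
        then show "real n powr (- c') \<le> 1" using elim by linarith
      qed
      also have "\<dots> \<le> exp (- ((real n powr c - 1) * real n powr (- c')))"
        using M(2)[of n] by (simp add: mult_right_mono)
      also have "(real n powr c - 1) * real n powr (- c') = real n powr (c - c') - real n powr (- c')"
        by (simp add: left_diff_distrib powr_add[symmetric])
      finally show ?case .
    qed
  qed
  have negl: "(\<lambda>n. C * (real (M n) * (real n ^ j * p n ^ k))) \<longlonglongrightarrow> 0"
    if "c + real j < real k * (1 + 1 / real l)" for j k and C :: real
  proof -
    have "(\<lambda>n. real (M n) * (real n ^ j * p n ^ k)) \<longlonglongrightarrow> 0"
      by (rule negligible[of "\<lambda>n. real (M n)" 1 c, OF _ _ that]) (use M(1) in auto)
    from tendsto_mult[OF tendsto_const[of C] this] show ?thesis by simp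
  qed
  have inv_le: "1 / real l \<le> 1" using l by simp
  \<comment> \<open>The exponent of \<open>n\<close> is c - 1/l: nuclei are unlikely in the searched
    planes, although among all \<open>m\<close> planes their mean number stays bounded away from
    0.\<close>
  have lines: "(\<lambda>n. 4 * (real (M n) * (real n ^ (l + 2) * p n ^ (l + 1)))) \<longlonglongrightarrow> 0"
  proof (rule negl)
    have "real (l + 1) * (1 + 1 / real l) = real (l + 2) + 1 / real l" using l by (simp add: field_simps)
    then show "c + real (l + 2) < real (l + 1) * (1 + 1 / real l)" using c by linarith
  qed
  \<comment> \<open>These crosses have only 2l sites. Over all \<open>m\<close> planes and for l = 1
    this bound would tend to a positive constant; over n^c planes the exponent is c - 1 < 0.\<close>
  have crosses: "(\<lambda>n. 32 * (real (M n) * (real n ^ (2 * l + 1) * p n ^ (2 * l)))) \<longlonglongrightarrow> 0"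
  proof (rule negl)
    have "real (2 * l) * (1 + 1 / real l) = real (2 * l + 1) + 1" using l by (simp add: field_simps)
    then show "c + real (2 * l + 1) < real (2 * l) * (1 + 1 / real l)" using c inv_le by linarith
  qed
  show ?thesis
  proof (rule real_tendsto_sandwich[OF _ _ tendsto_const])
    have "(\<lambda>n. 2 * (1 - (1 - tail n (p n) l) ^ n) ^ M n
      + 4 * (real (M n) * (real n ^ (l + 2) * p n ^ (l + 1)))
      + 32 * (real (M n) * (real n ^ (2 * l + 1) * p n ^ (2 * l)))) \<longlonglongrightarrow> 2 * 0 + 0 + 0"
      by (intro tendsto_add tendsto_mult tendsto_const block lines crosses)
    then show "(\<lambda>n. 2 * (1 - (1 - tail n (p n) l) ^ n) ^ M n
      + 4 * (real (M n) * (real n ^ (l + 2) * p n ^ (l + 1)))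
      + 32 * (real (M n) * (real n ^ (2 * l + 1) * p n ^ (2 * l)))) \<longlonglongrightarrow> 0" by simp
    show "\<forall>\<^sub>F n in sequentially. 0 \<le> span_prob n" by simp
    show "\<forall>\<^sub>F n in sequentially. span_prob n \<le> 2 * (1 - (1 - tail n (p n) l) ^ n) ^ M n
      + 4 * (real (M n) * (real n ^ (l + 2) * p n ^ (l + 1)))
      + 32 * (real (M n) * (real n ^ (2 * l + 1) * p n ^ (2 * l)))"
      using arc eventually_ge_at_top[of l]
    proof eventually_elim
      case (elim n)
      have "span_prob n \<le> 2 * (1 - (1 - tail n (p n) l) ^ n) ^ M n
        + 2 * real (2 * M n) * real n * (real (n choose (l + 1)) * p n ^ (l + 1))
        + real (2 * M n) * (16 * real n ^ (2 + (l - 1) + l) * p n ^ ((l - 1) + l + 1))"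
        using p01[of n] elim l by (intro prob_Span_le_blocked) auto
      moreover have "2 * real (2 * M n) * real n * (real (n choose (l + 1)) * p n ^ (l + 1)) \<le>
          2 * real (2 * M n) * real n * (real n ^ (l + 1) * p n ^ (l + 1))"
      proof (intro mult_left_mono mult_right_mono)
        show "real (n choose (l + 1)) \<le> real n ^ (l + 1)"
          using binomial_le_power[of n "l + 1"] by (metis of_nat_le_iff of_nat_power)
      qed (use p01 in auto)
      moreover have "2 * real (2 * M n) * real n * (real n ^ (l + 1) * p n ^ (l + 1)) =
          4 * (real (M n) * (real n ^ (l + 2) * p n ^ (l + 1)))"
        by simp
      moreover have "2 + (l - 1) + l = 2 * l + 1" "(l - 1) + l + 1 = 2 * l" using l by auto
      then have "real (2 * M n) * (16 * real n ^ (2 + (l - 1) + l) * p n ^ ((l - 1) + l + 1)) =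
          32 * (real (M n) * (real n ^ (2 * l + 1) * p n ^ (2 * l)))"
        by (simp only:)
      ultimately show ?case by linarith
    qed
  qed
qed

end


theorem theorem1p4:
  fixes l \<theta> :: nat and m :: "nat \<Rightarrow> nat" and p :: "nat \<Rightarrow> real" and a :: real
    and G :: "nat \<Rightarrow> (nat \<times> nat \<times> nat) pair_pre_digraph"
  assumes "l \<ge> 1" and "\<theta> = 2 * l + 1"
    and "(\<lambda>n. real (m n)) \<sim>[at_top]
           (\<lambda>n. real n powr (1 / real l) / ln (real n) powr (1 + 1 / real l))"
    and "a > 0"
    and "\<And>n. 0 \<le> p n \<and> p n \<le> 1"
    and "p \<sim>[at_top]
           (\<lambda>n. a * (ln (real n) powr (1 / real l) / real n powr (1 + 1 / real l)))"
    and "\<And>n. G n = cartesian_product (cycle_graph (m n))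
                    (cartesian_product (clique_graph n) (clique_graph n))"
  shows "(a ^ l / fact l < 1 / real l \<longrightarrow>
            (\<lambda>n. measure_pmf.prob (initial_pmf (G n) (p n)) (Span (G n) \<theta>)) \<longlonglongrightarrow> 0) \<and>
         (a ^ l / fact l > 1 / real l \<longrightarrow>
            (\<lambda>n. measure_pmf.prob (initial_pmf (G n) (p n)) (Span (G n) \<theta>))
              \<longlonglongrightarrow> 1 - exp (- 2 * a ^ (l + 1) / fact (l + 1)))"
proof -
  have G: "G n = cyc_cliques (m n) n" for n
    unfolding assms(7) cyc_cliques_def ..
  show ?thesis
    unfolding assms(2) initial_pmf_def G
    using span_prob_subcritical[OF assms(1,3-6)] span_prob_supercritical[OF assms(1,3-6)] by blast
qed

end
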